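(* For every $M\in L^2(\mathbb{T}^3)$ and every $PV_e\in H^{-1}$ the energy $$E(p)=\int_{\mathbb{T}^3}\left(\tfrac12|\nabla p|^2-\tfrac14\min(M-\partial_3p,0)^2\right)+\langle PV_e,p\rangle,\qquad p\in\mathring{H}^1,$$ has a unique global minimizer in $\mathring{H}^1$, which is also the unique $p\in\mathring{H}^1$ satisfying $$\int_{\mathbb{T}^3}\nabla p\cdot\nabla\phi+\tfrac12\min(M-\partial_3p,0)\,(\partial_3\phi)=-\langle PV_e,\phi\rangle\quad\text{for every }\phi\in\mathring{H}^1 .$$
   Context: $\mathbb{T}^3=(\mathbb{R}/L\mathbb{Z})^3$ is the 3-torus (with some fixed period $L>0$). $\mathring{H}^1=\{u\in L^2(\mathbb{T}^3):\nabla u\in L^2,\ \int_{\mathbb{T}^3}u=0\}$, $H^{-1}=(\mathring{H}^1)^*$ is its dual, and $\langle\cdot,\cdot\rangle$ is the $H^{-1}\times\mathring{H}^1$ duality pairing. *)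

theory Defs
  imports "HOL-Analysis.Analysis"
begin

text \<open>
  The torus \<open>(\<real>/L\<int>)\<^sup>3\<close> is represented by \<open>L\<close>-periodic functions on \<open>\<real>\<^sup>3\<close>, integrated over the
  fundamental cell \<open>[0,L)\<^sup>3\<close>.  Elements of \<open>L\<^sup>2\<close>, \<open>H\<^sup>1\<close> are given by representatives, so equality
  of elements of these spaces is equality almost everywhere.
\<close>

definition torus_periodic :: "real \<Rightarrow> (real^3 \<Rightarrow> real) \<Rightarrow> bool" where
  "torus_periodic L u \<longleftrightarrow> (\<forall>i x. u (x + L *\<^sub>R axis i 1) = u x)"

definition torus :: "real \<Rightarrow> (real^3) measure" where
  "torus L = lebesgue_on {x. \<forall>i. 0 \<le> x $ i \<and> x $ i < L}"

definition torus_L2 :: "real \<Rightarrow> (real^3 \<Rightarrow> real) set" where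
  "torus_L2 L = {u. torus_periodic L u \<and> u \<in> borel_measurable (torus L)
                    \<and> integrable (torus L) (\<lambda>x. (u x)\<^sup>2)}"

text \<open>Classical partial derivatives and \<open>C\<^sup>k\<close> functions.\<close>

definition partial :: "3 \<Rightarrow> (real^3 \<Rightarrow> real) \<Rightarrow> real^3 \<Rightarrow> real" where
  "partial i f x = frechet_derivative f (at x) (axis i 1)"

primrec Ck :: "nat \<Rightarrow> (real^3 \<Rightarrow> real) \<Rightarrow> bool" where
  "Ck 0 f \<longleftrightarrow> continuous_on UNIV f"
| "Ck (Suc k) f \<longleftrightarrow> f differentiable_on UNIV \<and> (\<forall>i. Ck k (partial i f))"

definition torus_test :: "real \<Rightarrow> (real^3 \<Rightarrow> real) set" where
  "torus_test L = {f. torus_periodic L f \<and> (\<forall>k. Ck k f)}"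

text \<open>
  \<open>g\<close> represents the distributional derivative \<open>\<partial>\<^sub>i u\<close>, and this derivative lies in \<open>L\<^sup>2\<close>.
\<close>

definition has_weak_partial ::
    "real \<Rightarrow> 3 \<Rightarrow> (real^3 \<Rightarrow> real) \<Rightarrow> (real^3 \<Rightarrow> real) \<Rightarrow> bool" where
  "has_weak_partial L i u g \<longleftrightarrow> g \<in> torus_L2 L \<and>
     (\<forall>f\<in>torus_test L.
        (\<integral>x. u x * partial i f x \<partial>torus L) = - (\<integral>x. g x * f x \<partial>torus L))"

text \<open>The choice is immaterial: weak derivatives are unique up to null sets.\<close>

definition weak_partial :: "real \<Rightarrow> 3 \<Rightarrow> (real^3 \<Rightarrow> real) \<Rightarrow> real^3 \<Rightarrow> real" where
  "weak_partial L i u = (SOME g. has_weak_partial L i u g)"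

definition weak_grad :: "real \<Rightarrow> (real^3 \<Rightarrow> real) \<Rightarrow> real^3 \<Rightarrow> real^3" where
  "weak_grad L u x = (\<chi> i. weak_partial L i u x)"

definition H1_mean_zero :: "real \<Rightarrow> (real^3 \<Rightarrow> real) set" where
  "H1_mean_zero L = {u \<in> torus_L2 L. (\<forall>i. \<exists>g. has_weak_partial L i u g)
                        \<and> (\<integral>x. u x \<partial>torus L) = 0}"

definition H1_norm :: "real \<Rightarrow> (real^3 \<Rightarrow> real) \<Rightarrow> real" where
  "H1_norm L u = sqrt (\<integral>x. (u x)\<^sup>2 + (norm (weak_grad L u x))\<^sup>2 \<partial>torus L)"

text \<open>
  Bounded linear functionals on the mean-zero \<open>H\<^sup>1\<close> space; the duality pairing is application.
  Linearity and boundedness force equal values on functions that agree almost everywhere.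
  Values outside the mean-zero \<open>H\<^sup>1\<close> space are irrelevant.
\<close>

definition H_minus1 :: "real \<Rightarrow> ((real^3 \<Rightarrow> real) \<Rightarrow> real) set" where
  "H_minus1 L = {F.
     (\<forall>u\<in>H1_mean_zero L. \<forall>v\<in>H1_mean_zero L. F (\<lambda>x. u x + v x) = F u + F v) \<and>
     (\<forall>u\<in>H1_mean_zero L. \<forall>c. F (\<lambda>x. c * u x) = c * F u) \<and>
     (\<exists>C. \<forall>u\<in>H1_mean_zero L. \<bar>F u\<bar> \<le> C * H1_norm L u)}"

definition energy ::
    "real \<Rightarrow> (real^3 \<Rightarrow> real) \<Rightarrow> ((real^3 \<Rightarrow> real) \<Rightarrow> real) \<Rightarrow> (real^3 \<Rightarrow> real) \<Rightarrow> real" where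
  "energy L M F p =
     (\<integral>x. 1/2 * (norm (weak_grad L p x))\<^sup>2 - 1/4 * (min (M x - weak_partial L 3 p x) 0)\<^sup>2 \<partial>torus L)
     + F p"

definition weak_solution ::
    "real \<Rightarrow> (real^3 \<Rightarrow> real) \<Rightarrow> ((real^3 \<Rightarrow> real) \<Rightarrow> real) \<Rightarrow> (real^3 \<Rightarrow> real) \<Rightarrow> bool" where
  "weak_solution L M F p \<longleftrightarrow> (\<forall>f\<in>H1_mean_zero L.
     (\<integral>x. weak_grad L p x \<bullet> weak_grad L f x
           + 1/2 * min (M x - weak_partial L 3 p x) 0 * weak_partial L 3 f x \<partial>torus L) = - F f)"

end

theory Submission
  imports Defs
begin

text \<open>
  The concave term \<open>- 1/4 min(m - s, 0)\<^sup>2\<close> has second derivative between \<open>- 1/2\<close> and \<open>0\<close> in \<open>s\<close>,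
  whereas \<open>1/2 |v|\<^sup>2\<close> has second derivative \<open>1\<close> in every direction.  The energy density is therefore
  uniformly convex with quadratic growth: it lies between paraboloids of curvature \<open>1/2\<close> and \<open>1\<close>
  touching it at any chosen point (\<open>energy_density_expansion\<close>).  Integration gives, for
  \<open>p\<close>, \<open>f\<close> in the mean-zero Sobolev space and the first variation \<open>G p f\<close>,

  \<open>1/4 t\<^sup>2 |\<nabla>f|\<^sup>2 \<le> E (p + t f) - E p - t G p f \<le> 1/2 t\<^sup>2 |\<nabla>f|\<^sup>2\<close>  (\<open>energy_expansion\<close>).

  These two inequalities carry the whole variational argument.  The upper one makes a minimizer
  critical and the lower one makes a critical point a minimizer whose competitors of equal energy
  have the same gradient.  The lower one expanded at a midpoint is a parallelogram
  inequality, which makes every minimizing sequence Cauchy in the gradient norm, so that no weak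
  compactness is used; expanded at the limit, it shows that the limit is a minimizer.

  What this needs from analysis is that the gradient norm is a complete norm on mean-zero functions
  modulo null sets and controls the full Sobolev norm: completeness of \<open>L\<^sup>2\<close>, uniqueness of
  weak derivatives, and the Poincare inequality.  The last two follow from the density of
  trigonometric polynomials in \<open>L\<^sup>2\<close> of the torus (\<open>trig_poly_dense\<close>, from the Stone--Weierstrass
  theorem on the torus embedded in \<open>\<complex>\<^sup>3\<close>).  For the Poincare inequality, a trigonometric
  polynomial \<open>f\<close> without constant term is written as \<open>\<Sum>\<^sub>i \<partial>\<^sub>i \<phi>\<^sub>i\<close> with trigonometric polynomials
  \<open>\<phi>\<^sub>i\<close> of \<open>L\<^sup>2\<close> norm at most \<open>L / (2 \<pi>) |f|\<close> (\<open>trig_poly_divergence\<close>); then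
  \<open>\<integral> u f = - \<Sum>\<^sub>i \<integral> (\<partial>\<^sub>i u) \<phi>\<^sub>i\<close> bounds \<open>\<integral> u f\<close> by the gradient of \<open>u\<close>, and \<open>f\<close> ranges over a dense set.
\<close>

section \<open>Square integrable functions\<close>

definition square_integrable :: "'a measure \<Rightarrow> ('a \<Rightarrow> real) set" where
  "square_integrable M = {u \<in> borel_measurable M. integrable M (\<lambda>x. (u x)\<^sup>2)}"

definition L2_norm :: "'a measure \<Rightarrow> ('a \<Rightarrow> real) \<Rightarrow> real" where
  "L2_norm M u = sqrt (\<integral>x. (u x)\<^sup>2 \<partial>M)"

lemma square_integrableD:
  assumes "u \<in> square_integrable M"
  shows "u \<in> borel_measurable M" "integrable M (\<lambda>x. (u x)\<^sup>2)"
  using assms by (auto simp: square_integrable_def)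

lemma L2_norm_nonneg [simp]: "L2_norm M u \<ge> 0"
  by (simp add: L2_norm_def)

lemma L2_norm_power2: "(L2_norm M u)\<^sup>2 = (\<integral>x. (u x)\<^sup>2 \<partial>M)"
  by (simp add: L2_norm_def)

lemma integrable_mult_square_integrable:
  assumes "u \<in> square_integrable M" "v \<in> square_integrable M"
  shows "integrable M (\<lambda>x. u x * v x)"
proof (rule Bochner_Integration.integrable_bound)
  note [measurable] = square_integrableD(1)[OF assms(1)] square_integrableD(1)[OF assms(2)]
  show "integrable M (\<lambda>x. (u x)\<^sup>2 + (v x)\<^sup>2)"
    using assms by (intro Bochner_Integration.integrable_add square_integrableD)
  show "(\<lambda>x. u x * v x) \<in> borel_measurable M" by measurable
  have "\<bar>a * b\<bar> \<le> a\<^sup>2 + b\<^sup>2" for a b :: real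
  proof -
    have "0 \<le> (\<bar>a\<bar> - \<bar>b\<bar>)\<^sup>2" by simp
    hence "2 * (\<bar>a\<bar> * \<bar>b\<bar>) \<le> a\<^sup>2 + b\<^sup>2" by (simp add: power2_diff algebra_simps)
    moreover have "0 \<le> \<bar>a\<bar> * \<bar>b\<bar>" by simp
    ultimately show ?thesis unfolding abs_mult by linarith
  qed
  thus "AE x in M. norm (u x * v x) \<le> norm ((u x)\<^sup>2 + (v x)\<^sup>2)" by simp
qed

lemma square_integrable_cmult:
  assumes "u \<in> square_integrable M"
  shows "(\<lambda>x. c * u x) \<in> square_integrable M"
  using assms by (auto simp: square_integrable_def power_mult_distrib)

lemma square_integrable_add:
  assumes "u \<in> square_integrable M" "v \<in> square_integrable M"
  shows "(\<lambda>x. u x + v x) \<in> square_integrable M"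
proof -
  have "integrable M (\<lambda>x. (u x)\<^sup>2 + (v x)\<^sup>2 + 2 * (u x * v x))"
    using assms
    by (intro Bochner_Integration.integrable_add square_integrableD integrable_mult_right
          integrable_mult_square_integrable)
  thus ?thesis
    using assms by (auto simp: square_integrable_def power2_sum algebra_simps)
qed

lemma square_integrable_diff:
  assumes "u \<in> square_integrable M" "v \<in> square_integrable M"
  shows "(\<lambda>x. u x - v x) \<in> square_integrable M"
  using square_integrable_add[OF assms(1) square_integrable_cmult[OF assms(2), of "-1"]] by simp

lemma square_integrable_bounded:
  assumes "finite_measure M" "u \<in> borel_measurable M" "AE x in M. \<bar>u x\<bar> \<le> B"
  shows "u \<in> square_integrable M"
proof -
  interpret finite_measure M by fact
  have "integrable M (\<lambda>x. (u x)\<^sup>2)"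
  proof (rule integrable_const_bound)
    show "AE x in M. norm ((u x)\<^sup>2) \<le> B\<^sup>2"
      using assms(3) by eventually_elim (simp add: abs_le_square_iff [symmetric])
  qed (use assms in measurable)
  thus ?thesis using assms by (auto simp: square_integrable_def)
qed

lemma integral_square_add:
  assumes "u \<in> square_integrable M" "v \<in> square_integrable M"
  shows "(\<integral>x. (u x + t * v x)\<^sup>2 \<partial>M)
           = (\<integral>x. (u x)\<^sup>2 \<partial>M) + 2 * t * (\<integral>x. u x * v x \<partial>M) + t\<^sup>2 * (\<integral>x. (v x)\<^sup>2 \<partial>M)"
proof -
  have "(\<integral>x. (u x + t * v x)\<^sup>2 \<partial>M)
      = (\<integral>x. (u x)\<^sup>2 + (2 * t * (u x * v x) + t\<^sup>2 * (v x)\<^sup>2) \<partial>M)"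
    by (rule Bochner_Integration.integral_cong) (auto simp: power2_sum algebra_simps)
  also have "\<dots> = (\<integral>x. (u x)\<^sup>2 \<partial>M) + (\<integral>x. 2 * t * (u x * v x) + t\<^sup>2 * (v x)\<^sup>2 \<partial>M)"
    using assms
    by (intro Bochner_Integration.integral_add Bochner_Integration.integrable_add
        integrable_mult_right integrable_mult_square_integrable square_integrableD)
  also have "(\<integral>x. 2 * t * (u x * v x) + t\<^sup>2 * (v x)\<^sup>2 \<partial>M)
      = (\<integral>x. 2 * t * (u x * v x) \<partial>M) + (\<integral>x. t\<^sup>2 * (v x)\<^sup>2 \<partial>M)"
    using assms
    by (intro Bochner_Integration.integral_add
        integrable_mult_right integrable_mult_square_integrable square_integrableD)
  finally show ?thesis by simp
qed

text \<open>
  The quadratic \<open>t \<mapsto> \<integral> (u + t v)\<^sup>2\<close> is nonnegative, so its discriminant is not positive.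
\<close>

lemma Cauchy_Schwarz_integral:
  assumes "u \<in> square_integrable M" "v \<in> square_integrable M"
  shows "\<bar>\<integral>x. u x * v x \<partial>M\<bar> \<le> L2_norm M u * L2_norm M v"
proof -
  define A B C where "A = (\<integral>x. (u x)\<^sup>2 \<partial>M)" and "B = (\<integral>x. u x * v x \<partial>M)" and "C = (\<integral>x. (v x)\<^sup>2 \<partial>M)"
  have q: "0 \<le> A + 2 * t * B + t\<^sup>2 * C" for t
  proof -
    have "0 \<le> (\<integral>x. (u x + t * v x)\<^sup>2 \<partial>M)" by simp
    thus ?thesis using integral_square_add[OF assms, of t] by (simp add: A_def B_def C_def)
  qed
  have nn: "A \<ge> 0" "C \<ge> 0" by (simp_all add: A_def C_def)
  have "B\<^sup>2 \<le> A * C"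
  proof (cases "C = 0")
    case True
    have "B = 0"
    proof (rule ccontr)
      \<comment> \<open>A nonconstant affine function of \<open>t\<close> takes the value \<open>-1\<close>.\<close>
      assume "B \<noteq> 0"
      thus False using q[of "- (A + 1) / (2 * B)"] True by (simp add: field_simps)
    qed
    thus ?thesis using True by simp
  next
    case False
    hence "C > 0" using nn by simp
    \<comment> \<open>the minimum point of the quadratic in \<open>t\<close>\<close>
    thus ?thesis using q[of "- B / C"] by (simp add: field_simps power2_eq_square)
  qed
  hence "sqrt (B\<^sup>2) \<le> sqrt (A * C)" by (rule real_sqrt_le_mono)
  thus ?thesis by (simp add: L2_norm_def A_def B_def C_def real_sqrt_mult)
qed

lemma L2_norm_cmult: "L2_norm M (\<lambda>x. c * u x) = \<bar>c\<bar> * L2_norm M u"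
  by (simp add: L2_norm_def power_mult_distrib real_sqrt_mult)

lemma L2_norm_triangle:
  assumes "u \<in> square_integrable M" "v \<in> square_integrable M"
  shows "L2_norm M (\<lambda>x. u x + v x) \<le> L2_norm M u + L2_norm M v"
proof (rule power2_le_imp_le)
  have "(L2_norm M (\<lambda>x. u x + v x))\<^sup>2
      = (L2_norm M u)\<^sup>2 + 2 * (\<integral>x. u x * v x \<partial>M) + (L2_norm M v)\<^sup>2"
    using integral_square_add[OF assms, of 1] by (simp add: L2_norm_power2)
  also have "\<dots> \<le> (L2_norm M u)\<^sup>2 + 2 * (L2_norm M u * L2_norm M v) + (L2_norm M v)\<^sup>2"
    using Cauchy_Schwarz_integral[OF assms] by simp
  finally show "(L2_norm M (\<lambda>x. u x + v x))\<^sup>2 \<le> (L2_norm M u + L2_norm M v)\<^sup>2"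
    by (simp add: power2_sum)
qed simp

lemma L2_norm_triangle_diff:
  assumes "u \<in> square_integrable M" "v \<in> square_integrable M" "w \<in> square_integrable M"
  shows "L2_norm M (\<lambda>x. u x - w x) \<le> L2_norm M (\<lambda>x. u x - v x) + L2_norm M (\<lambda>x. v x - w x)"
  using L2_norm_triangle[OF square_integrable_diff[OF assms(1,2)] square_integrable_diff[OF assms(2,3)]]
  by simp

lemma L2_norm_commute: "L2_norm M (\<lambda>x. u x - v x) = L2_norm M (\<lambda>x. v x - u x)"
  by (simp add: L2_norm_def power2_commute)

lemma L2_norm_eq_0_AE:
  assumes "u \<in> square_integrable M" "L2_norm M u = 0"
  shows "AE x in M. u x = 0"
proof -
  have "(\<integral>x. (u x)\<^sup>2 \<partial>M) = 0" using assms(2) by (simp add: L2_norm_def)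
  hence "AE x in M. (u x)\<^sup>2 = 0"
    using integral_nonneg_eq_0_iff_AE[OF square_integrableD(2)[OF assms(1)]] by simp
  thus ?thesis by simp
qed

lemma L2_norm_cong_AE:
  assumes "AE x in M. u x = v x" "u \<in> borel_measurable M" "v \<in> borel_measurable M"
  shows "L2_norm M u = L2_norm M v"
proof -
  note [measurable] = assms(2,3)
  have "(\<integral>x. (u x)\<^sup>2 \<partial>M) = (\<integral>x. (v x)\<^sup>2 \<partial>M)"
    by (rule integral_cong_AE) (use assms(1) in auto)
  thus ?thesis by (simp add: L2_norm_def)
qed

lemma L2_norm_tendsto_0_dominated:
  assumes "finite_measure M" "\<And>n. f n \<in> borel_measurable M" "u \<in> borel_measurable M"
    and lim: "AE x in M. (\<lambda>n. f n x) \<longlonglongrightarrow> u x"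
    and dom: "h \<in> square_integrable M" "\<And>n. AE x in M. \<bar>f n x - u x\<bar> \<le> h x"
  shows "(\<lambda>n. L2_norm M (\<lambda>x. f n x - u x)) \<longlonglongrightarrow> 0"
proof -
  note [measurable] = assms(2,3)
  have "(\<lambda>n. \<integral>x. (f n x - u x)\<^sup>2 \<partial>M) \<longlonglongrightarrow> (\<integral>x. 0 \<partial>M)"
  proof (rule integral_dominated_convergence)
    show "integrable M (\<lambda>x. (h x)\<^sup>2)" by (rule square_integrableD[OF dom(1)])
    show "AE x in M. (\<lambda>n. (f n x - u x)\<^sup>2) \<longlonglongrightarrow> 0"
      using lim
    proof eventually_elim
      case (elim x)
      have "(\<lambda>n. (f n x - u x)\<^sup>2) \<longlonglongrightarrow> (u x - u x)\<^sup>2" by (intro tendsto_intros elim)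
      thus ?case by simp
    qed
    show "AE x in M. norm ((f n x - u x)\<^sup>2) \<le> (h x)\<^sup>2" for n
      using dom(2)[of n] by eventually_elim (simp add: abs_le_square_iff [symmetric])
  qed auto
  from tendsto_real_sqrt[OF this] show ?thesis by (simp add: L2_norm_def)
qed

text \<open>
  Completeness of \<open>L\<^sup>2\<close>, with the limit given pointwise by a subsequence: a subsequence with
  geometrically decreasing increments converges almost everywhere, because the increments are
  summable in \<open>L\<^sup>1\<close>, and Fatou's lemma identifies its pointwise limit as the \<open>L\<^sup>2\<close> limit.
  The explicit pointwise form of the limit is what later makes it inherit periodicity.
\<close>

lemma L2_complete:
  assumes M: "finite_measure M" and f: "\<And>n. f n \<in> square_integrable M"
    and Cauchy: "\<And>e. e > 0 \<Longrightarrow> \<exists>N. \<forall>m\<ge>N. \<forall>n\<ge>N. L2_norm M (\<lambda>x. f m x - f n x) < e"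
  shows "\<exists>r::nat \<Rightarrow> nat. (\<lambda>x. lim (\<lambda>n. f (r n) x)) \<in> square_integrable M \<and>
           (\<lambda>n. L2_norm M (\<lambda>x. f n x - lim (\<lambda>n. f (r n) x))) \<longlonglongrightarrow> 0"
proof -
  interpret finite_measure M by fact
  note [measurable] = square_integrableD(1)[OF f]
  obtain N where N: "\<And>k m n. m \<ge> N k \<Longrightarrow> n \<ge> N k \<Longrightarrow> L2_norm M (\<lambda>x. f m x - f n x) < (1/2)^k"
  proof -
    have "\<forall>k. \<exists>N. \<forall>m\<ge>N. \<forall>n\<ge>N. L2_norm M (\<lambda>x. f m x - f n x) < (1/2)^k"
      by (intro allI Cauchy) simp
    then obtain N where "\<forall>k. \<forall>m\<ge>N k. \<forall>n\<ge>N k. L2_norm M (\<lambda>x. f m x - f n x) < (1/2)^k"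
      by (rule choice [THEN exE]) blast
    thus ?thesis by (intro that) blast
  qed
  have "\<exists>r::nat\<Rightarrow>nat. \<forall>k. r k \<ge> N k \<and> r (Suc k) > r k"
  proof (rule dependent_nat_choice)
    show "\<exists>x. N 0 \<le> x" by blast
    show "\<exists>y\<ge>N (Suc n). x < y" for x n
      by (rule exI[of _ "max (N (Suc n)) (Suc x)"]) auto
  qed
  then obtain r where r: "\<And>k. r k \<ge> N k" "\<And>k. r (Suc k) > r k" by blast
  have sm: "strict_mono r" using r(2) by (simp add: strict_mono_Suc_iff)
  define u where "u x = lim (\<lambda>n. f (r n) x)" for x
  have u[measurable]: "u \<in> borel_measurable M" unfolding u_def by measurable
  define a where "a n x = \<bar>f (r (Suc n)) x - f (r n) x\<bar>" for n x
  have a[measurable]: "a n \<in> borel_measurable M" for n unfolding a_def by measurable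
  have one: "(\<lambda>x. 1) \<in> square_integrable M" by (auto simp: square_integrable_def)
  have aL2: "a n \<in> square_integrable M" for n
    using square_integrable_diff[OF f[of "r (Suc n)"] f[of "r n"]] a[of n]
    by (auto simp: square_integrable_def a_def)
  have aint: "integrable M (a n)" for n
    using integrable_mult_square_integrable[OF aL2 one] by simp
  define V where "V = L2_norm M (\<lambda>x. 1::real)"
  \<comment> \<open>On a finite measure space the increments are summable in \<open>L\<^sup>1\<close> as well.\<close>
  have abound: "(\<integral>x. a n x \<partial>M) \<le> (1/2)^n * V" for n
  proof -
    have "(\<integral>x. a n x \<partial>M) \<le> L2_norm M (a n) * V"
      using Cauchy_Schwarz_integral[OF aL2 one, of n] by (simp add: V_def)
    also have "L2_norm M (a n) = L2_norm M (\<lambda>x. f (r (Suc n)) x - f (r n) x)"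
      by (simp add: L2_norm_def a_def)
    also have "\<dots> \<le> (1/2)^n"
      using N[of n "r (Suc n)" "r n"] r(1)[of n] r(2)[of n] by (simp add: less_eq_real_def)
    finally show ?thesis by (simp add: V_def mult_right_mono)
  qed
  have "(\<integral>\<^sup>+x. (\<Sum>n. ennreal (a n x)) \<partial>M) = (\<Sum>n. \<integral>\<^sup>+x. ennreal (a n x) \<partial>M)"
    by (rule nn_integral_suminf) simp
  also have "\<dots> = (\<Sum>n. ennreal (\<integral>x. a n x \<partial>M))"
    by (intro suminf_cong nn_integral_eq_integral aint) (auto simp: a_def)
  also have "\<dots> \<le> (\<Sum>n. ennreal ((1/2)^n * V))"
    by (intro suminf_le ennreal_leI abound) auto
  also have "\<dots> = ennreal (\<Sum>n. (1/2)^n * V)"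
    by (rule suminf_ennreal2) (auto simp: V_def intro!: summable_mult2 summable_geometric)
  finally have fin: "(\<integral>\<^sup>+x. (\<Sum>n. ennreal (a n x)) \<partial>M) \<noteq> \<infinity>"
    by (auto simp: top_unique)
  have "AE x in M. (\<Sum>n. ennreal (a n x)) \<noteq> \<infinity>"
    by (rule nn_integral_PInf_AE[OF _ fin]) measurable
  hence conv: "AE x in M. (\<lambda>n. f (r n) x) \<longlonglongrightarrow> u x"
  proof eventually_elim
    case (elim x)
    have "summable (\<lambda>n. a n x)"
      by (rule summable_suminf_not_top) (use elim in \<open>auto simp: a_def\<close>)
    hence "summable (\<lambda>n. f (r (Suc n)) x - f (r n) x)"
      unfolding a_def by (rule summable_rabs_cancel)
    hence "convergent (\<lambda>n. \<Sum>k<n. f (r (Suc k)) x - f (r k) x)"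
      by (simp add: summable_iff_convergent)
    hence "convergent (\<lambda>n. f (r n) x - f (r 0) x)"
      by (simp add: sum_lessThan_telescope[of "\<lambda>k. f (r k) x"])
    hence "convergent (\<lambda>n. f (r n) x)"
      by (simp only: convergent_diff_const_right_iff)
    thus ?case by (simp add: u_def convergent_LIMSEQ_iff)
  qed
  \<comment> \<open>Bounds on \<open>f m - f (r n)\<close> survive the passage to the pointwise limit in \<open>n\<close>.\<close>
  have Fatou: "(\<integral>\<^sup>+x. ennreal ((f m x - u x)\<^sup>2) \<partial>M) \<le> ennreal (e\<^sup>2)"
    if e: "e > 0" and K: "\<forall>n\<ge>K. L2_norm M (\<lambda>x. f m x - f n x) < e" for m K e
  proof -
    have "(\<integral>\<^sup>+x. ennreal ((f m x - u x)\<^sup>2) \<partial>M)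
        = (\<integral>\<^sup>+x. liminf (\<lambda>n. ennreal ((f m x - f (r n) x)\<^sup>2)) \<partial>M)"
    proof (rule nn_integral_cong_AE)
      show "AE x in M. ennreal ((f m x - u x)\<^sup>2) = liminf (\<lambda>n. ennreal ((f m x - f (r n) x)\<^sup>2))"
        using conv
      proof eventually_elim
        case (elim x)
        have "(\<lambda>n. ennreal ((f m x - f (r n) x)\<^sup>2)) \<longlonglongrightarrow> ennreal ((f m x - u x)\<^sup>2)"
          by (intro tendsto_ennrealI tendsto_intros elim)
        from lim_imp_Liminf[OF _ this] show ?case by simp
      qed
    qed
    also have "\<dots> \<le> liminf (\<lambda>n. \<integral>\<^sup>+x. ennreal ((f m x - f (r n) x)\<^sup>2) \<partial>M)"
      by (rule nn_integral_liminf) measurable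
    also have "\<dots> \<le> ennreal (e\<^sup>2)"
    proof (rule Liminf_le)
      show "\<forall>\<^sub>F n in sequentially. (\<integral>\<^sup>+x. ennreal ((f m x - f (r n) x)\<^sup>2) \<partial>M) \<le> ennreal (e\<^sup>2)"
      proof (rule eventually_sequentiallyI[of K])
        fix n assume "n \<ge> K"
        hence "L2_norm M (\<lambda>x. f m x - f (r n) x) < e"
          using K seq_suble[OF sm, of n] by (meson order_trans)
        hence "(L2_norm M (\<lambda>x. f m x - f (r n) x))\<^sup>2 \<le> e\<^sup>2"
          by (intro power_mono) auto
        hence "(\<integral>x. (f m x - f (r n) x)\<^sup>2 \<partial>M) \<le> e\<^sup>2" by (simp add: L2_norm_power2)
        moreover have "(\<integral>\<^sup>+x. ennreal ((f m x - f (r n) x)\<^sup>2) \<partial>M)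
            = ennreal (\<integral>x. (f m x - f (r n) x)\<^sup>2 \<partial>M)"
          by (rule nn_integral_eq_integral)
             (auto intro!: square_integrableD square_integrable_diff f)
        ultimately show "(\<integral>\<^sup>+x. ennreal ((f m x - f (r n) x)\<^sup>2) \<partial>M) \<le> ennreal (e\<^sup>2)"
          by (simp add: ennreal_leI)
      qed
    qed simp
    finally show ?thesis .
  qed
  have diffL2: "(\<lambda>x. f m x - u x) \<in> square_integrable M"
    and diffbd: "L2_norm M (\<lambda>x. f m x - u x) \<le> e"
    if e: "e > 0" and K: "\<forall>n\<ge>K. L2_norm M (\<lambda>x. f m x - f n x) < e" for m K e
  proof -
    note F = Fatou[OF e K]
    have int: "integrable M (\<lambda>x. (f m x - u x)\<^sup>2)"
    proof (rule integrableI_bounded)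
      show "(\<integral>\<^sup>+x. ennreal (norm ((f m x - u x)\<^sup>2)) \<partial>M) < \<infinity>"
        using order_le_less_trans[OF F] by simp
    qed measurable
    thus "(\<lambda>x. f m x - u x) \<in> square_integrable M" by (auto simp: square_integrable_def)
    have "ennreal (\<integral>x. (f m x - u x)\<^sup>2 \<partial>M) \<le> ennreal (e\<^sup>2)"
      using F nn_integral_eq_integral[OF int] by simp
    hence "(L2_norm M (\<lambda>x. f m x - u x))\<^sup>2 \<le> e\<^sup>2" by (simp add: L2_norm_power2)
    thus "L2_norm M (\<lambda>x. f m x - u x) \<le> e" using e by (rule power2_le_imp_le [OF _ less_imp_le])
  qed
  have "u \<in> square_integrable M"
  proof -
    obtain K where "\<forall>m\<ge>K. \<forall>n\<ge>K. L2_norm M (\<lambda>x. f m x - f n x) < 1" using Cauchy[of 1] by auto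
    hence "(\<lambda>x. f K x - u x) \<in> square_integrable M" by (intro diffL2[of 1 K]) auto
    from square_integrable_diff[OF f[of K] this] show ?thesis by simp
  qed
  moreover have "(\<lambda>n. L2_norm M (\<lambda>x. f n x - u x)) \<longlonglongrightarrow> 0"
  proof (rule LIMSEQ_I)
    fix e :: real assume "e > 0"
    then obtain K where K: "\<forall>m\<ge>K. \<forall>n\<ge>K. L2_norm M (\<lambda>x. f m x - f n x) < e / 2"
      using Cauchy[of "e / 2"] by auto
    have "L2_norm M (\<lambda>x. f m x - u x) < e" if "m \<ge> K" for m
      using diffbd[of "e / 2" K m] K that \<open>e > 0\<close> by auto
    thus "\<exists>no. \<forall>n\<ge>no. norm (L2_norm M (\<lambda>x. f n x - u x) - 0) < e" by auto
  qed
  ultimately show ?thesis unfolding u_def by blast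
qed

section \<open>The torus cell and trigonometric polynomials\<close>

definition cell :: "real \<Rightarrow> (real^3) set" where
  "cell L = {x. \<forall>i. 0 \<le> x $ i \<and> x $ i < L}"

lemma cell_borel [measurable]: "cell L \<in> sets borel"
proof -
  have "cell L = (\<Inter>i. {x. 0 \<le> x $ i} \<inter> {x. x $ i < L})" by (auto simp: cell_def)
  also have "\<dots> \<in> sets borel"
    by (intro sets.countable_INT' sets.Int borel_closed borel_open)
       (auto intro!: closed_Collect_le open_Collect_less continuous_intros simp: countable_finite)
  finally show ?thesis .
qed

lemma cell_lebesgue: "cell L \<in> sets lebesgue"
  by (simp add: cell_borel sets_completionI_sets)

lemma cell_subset_cbox: "cell L \<subseteq> cbox 0 (\<chi> i. L)"
  by (auto simp: cell_def mem_box_cart less_imp_le)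

lemma torus_eq: "torus L = lebesgue_on (cell L)"
  by (simp add: torus_def cell_def)

lemma space_torus [simp]: "space (torus L) = cell L"
  by (simp add: torus_eq)

lemma emeasure_cell_finite: "emeasure lborel (cell L) < \<infinity>"
  by (rule order_le_less_trans[OF emeasure_mono[OF cell_subset_cbox]]) (auto simp: emeasure_lborel_cbox_eq)

lemma finite_measure_torus: "finite_measure (torus L)"
proof
  show "emeasure (torus L) (space (torus L)) \<noteq> \<infinity>"
    using emeasure_cell_finite[of L] cell_lebesgue[of L]
    by (simp add: torus_eq emeasure_restrict_space)
qed

lemma continuous_measurable_torus:
  fixes f :: "real^3 \<Rightarrow> real"
  assumes "continuous_on UNIV f"
  shows "f \<in> borel_measurable (torus L)"
  unfolding torus_eq
  by (intro measurable_restrict_space1 measurable_completion)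
     (use borel_measurable_continuous_onI[OF assms] in simp)

lemma continuous_square_integrable_torus:
  fixes f :: "real^3 \<Rightarrow> real"
  assumes "continuous_on UNIV f"
  shows "f \<in> square_integrable (torus L)"
proof -
  have "compact (f ` cbox 0 (\<chi> i. L))"
    by (intro compact_continuous_image compact_cbox continuous_on_subset[OF assms]) auto
  hence "bounded (f ` cbox 0 (\<chi> i. L))" by (rule compact_imp_bounded)
  then obtain B where B: "\<And>x. x \<in> cbox 0 (\<chi> i. L) \<Longrightarrow> \<bar>f x\<bar> \<le> B"
    by (auto simp: bounded_iff)
  show ?thesis
    by (rule square_integrable_bounded[where B = B])
       (use B cell_subset_cbox[of L] in
         \<open>auto intro!: finite_measure_torus continuous_measurable_torus assms AE_I2\<close>)
qed

lemma torus_L2_iff: "u \<in> torus_L2 L \<longleftrightarrow> torus_periodic L u \<and> u \<in> square_integrable (torus L)"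
  by (auto simp: torus_L2_def square_integrable_def)

lemma integral_torus_lborel:
  fixes f :: "real^3 \<Rightarrow> real"
  assumes [measurable]: "f \<in> borel_measurable borel"
  shows "(\<integral>x. f x \<partial>torus L) = (\<integral>x. indicator (cell L) x * f x \<partial>lborel)"
proof -
  have "(\<integral>x. f x \<partial>torus L) = (\<integral>x. indicator (cell L) x *\<^sub>R f x \<partial>lebesgue)"
    unfolding torus_eq using cell_lebesgue by (subst integral_restrict_space) auto
  also have "\<dots> = (\<integral>x. indicator (cell L) x *\<^sub>R f x \<partial>lborel)"
    by (rule integral_completion) measurable
  finally show ?thesis by simp
qed

lemma integral_lborel_translate:
  fixes f :: "'a::euclidean_space \<Rightarrow> real"
  assumes [measurable]: "f \<in> borel_measurable borel"
  shows "(\<integral>x. f (x + a) \<partial>lborel) = (\<integral>x. f x \<partial>lborel)"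
proof -
  have "(\<integral>x. f x \<partial>lborel) = (\<integral>x. f x \<partial>distr lborel borel ((+) a))"
    by (simp add: lborel_distr_plus)
  also have "\<dots> = (\<integral>x. f (a + x) \<partial>lborel)"
    by (rule integral_distr) measurable
  finally show ?thesis by (simp add: add.commute)
qed

text \<open>
  The shifted cell differs from the cell by a slab that periodicity moves back to the opposite side.
  A shift by at most one period suffices for what follows and leaves only one slab to be moved.
\<close>

lemma integral_torus_shift:
  fixes f :: "real^3 \<Rightarrow> real"
  assumes f [measurable]: "f \<in> borel_measurable borel" and bd: "\<And>x. \<bar>f x\<bar> \<le> B"
    and per: "\<And>x. f (x + L *\<^sub>R axis i 1) = f x" and h: "0 \<le> h" "h \<le> L"
  shows "(\<integral>x. f (x + h *\<^sub>R axis i 1) \<partial>torus L) = (\<integral>x. f x \<partial>torus L)"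
proof -
  \<comment> \<open>\<open>P\<close> is the part of the cell inside the shifted cell; \<open>Q\<close> is the slab that a translation by
    one period carries onto the rest of the shifted cell.\<close>
  define P Q where "P = cell L \<inter> {x. h \<le> x $ i}" and "Q = cell L \<inter> {x. x $ i < h}"
  have [measurable]: "P \<in> sets borel" "Q \<in> sets borel"
    unfolding P_def Q_def
    by (auto intro!: sets.Int borel_closed borel_open closed_Collect_le open_Collect_less
          continuous_intros)
  have int: "integrable lborel (\<lambda>x. indicator S x * f x)"
    if S [measurable]: "S \<in> sets borel" and "S \<subseteq> cell L" for S
  proof (rule Bochner_Integration.integrable_bound)
    have "emeasure lborel S < \<infinity>"
      using emeasure_mono[OF \<open>S \<subseteq> cell L\<close>, of lborel] emeasure_cell_finite[of L]
      by (auto intro: order_le_less_trans)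
    thus "integrable lborel (\<lambda>x. B * indicator S x)"
      by (intro integrable_mult_right integrable_real_indicator) auto
    show "AE x in lborel. norm (indicator S x * f x) \<le> norm (B * indicator S x)"
      using bd by (intro AE_I2) (auto simp: indicator_def intro: order_trans[OF _ abs_ge_self])
  qed measurable
  have int2: "integrable lborel (\<lambda>x. indicator Q (x - L *\<^sub>R axis i 1) * f x)"
  proof -
    have "integrable (distr lborel borel ((+) (L *\<^sub>R axis i 1))) (\<lambda>x. indicator Q (x - L *\<^sub>R axis i 1) * f x)"
      using int[of Q] per
      by (subst integrable_distr_eq) (auto simp: Q_def add.commute)
    thus ?thesis by (simp add: lborel_distr_plus)
  qed
  have "(\<integral>x. f (x + h *\<^sub>R axis i 1) \<partial>torus L)
      = (\<integral>x. indicator (cell L) x * f (x + h *\<^sub>R axis i 1) \<partial>lborel)"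
    by (rule integral_torus_lborel) measurable
  also have "\<dots> = (\<integral>y. indicator (cell L) (y - h *\<^sub>R axis i 1) * f y \<partial>lborel)"
    using integral_lborel_translate[of "\<lambda>y. indicator (cell L) (y - h *\<^sub>R axis i 1) * f y" "h *\<^sub>R axis i 1"]
    by simp
  also have "\<dots> = (\<integral>y. indicator P y * f y + indicator Q (y - L *\<^sub>R axis i 1) * f y \<partial>lborel)"
  proof (rule Bochner_Integration.integral_cong)
    fix y :: "real^3"
    have 1: "y - h *\<^sub>R axis i 1 \<in> cell L \<longleftrightarrow> y \<in> P \<or> y - L *\<^sub>R axis i 1 \<in> Q"
    proof -
      have "(\<forall>j. 0 \<le> y$j - h * axis i 1 $ j \<and> y$j - h * axis i 1 $ j < L) \<longleftrightarrow>
         (\<forall>j. j \<noteq> i \<longrightarrow> 0 \<le> y$j \<and> y$j < L) \<and> h \<le> y$i \<and> y$i < L + h"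
        by (auto simp: axis_def algebra_simps)
      moreover have "y \<in> P \<longleftrightarrow> (\<forall>j. j \<noteq> i \<longrightarrow> 0 \<le> y$j \<and> y$j < L) \<and> h \<le> y$i \<and> y$i < L"
        using h by (auto simp: P_def cell_def) (metis order_trans)+
      moreover have "y - L *\<^sub>R axis i 1 \<in> Q \<longleftrightarrow>
          (\<forall>j. j \<noteq> i \<longrightarrow> 0 \<le> y$j \<and> y$j < L) \<and> L \<le> y$i \<and> y$i < L + h"
      proof -
        have "y - L *\<^sub>R axis i 1 \<in> Q \<longleftrightarrow>
          (\<forall>j. 0 \<le> y$j - L * axis i 1 $ j \<and> y$j - L * axis i 1 $ j < L) \<and> y$i - L < h"
          by (auto simp: Q_def cell_def)
        also have "(\<forall>j. 0 \<le> y$j - L * axis i 1 $ j \<and> y$j - L * axis i 1 $ j < L) \<longleftrightarrow>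
           (\<forall>j. j \<noteq> i \<longrightarrow> 0 \<le> y$j \<and> y$j < L) \<and> L \<le> y$i \<and> y$i < L + L"
          by (auto simp: axis_def algebra_simps)
        finally show ?thesis using h by auto
      qed
      ultimately show ?thesis using h by (auto simp: cell_def)
    qed
    moreover have "\<not> (y \<in> P \<and> y - L *\<^sub>R axis i 1 \<in> Q)"
      by (auto simp: P_def Q_def cell_def dest!: spec[of _ i])
    ultimately show "indicator (cell L) (y - h *\<^sub>R axis i 1) * f y
        = indicator P y * f y + indicator Q (y - L *\<^sub>R axis i 1) * f y"
      by (auto simp: indicator_def)
  qed simp
  also have "\<dots> = (\<integral>y. indicator P y * f y \<partial>lborel)
      + (\<integral>y. indicator Q (y - L *\<^sub>R axis i 1) * f y \<partial>lborel)"
    by (rule Bochner_Integration.integral_add) (use int[of P] int2 in \<open>auto simp: P_def\<close>)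
  also have "(\<integral>y. indicator Q (y - L *\<^sub>R axis i 1) * f y \<partial>lborel) = (\<integral>y. indicator Q y * f y \<partial>lborel)"
    using integral_lborel_translate[of "\<lambda>y. indicator Q (y - L *\<^sub>R axis i 1) * f y" "L *\<^sub>R axis i 1"] per
    by simp
  also have "(\<integral>y. indicator P y * f y \<partial>lborel) + (\<integral>y. indicator Q y * f y \<partial>lborel)
      = (\<integral>y. indicator P y * f y + indicator Q y * f y \<partial>lborel)"
    by (rule Bochner_Integration.integral_add [symmetric])
       (use int[of P] int[of Q] in \<open>auto simp: P_def Q_def\<close>)
  also have "\<dots> = (\<integral>y. indicator (cell L) y * f y \<partial>lborel)"
    by (rule Bochner_Integration.integral_cong) (auto simp: P_def Q_def indicator_def)
  finally show ?thesis by (simp add: integral_torus_lborel)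
qed

definition phase :: "real \<Rightarrow> int^3 \<Rightarrow> real^3 \<Rightarrow> real" where
  "phase L k x = 2 * pi / L * (\<Sum>i\<in>UNIV. of_int (k $ i) * x $ i)"

text \<open>
  Complex coefficients are used because the waves \<open>cis (phase L k x)\<close> are closed under products and
  orthogonal for distinct \<open>k\<close>, which fails for real cosines and sines indexed by the same lattice;
  the real objects of interest are the real parts.
\<close>

definition trig_poly :: "real \<Rightarrow> (int^3) set \<Rightarrow> (int^3 \<Rightarrow> complex) \<Rightarrow> real^3 \<Rightarrow> complex" where
  "trig_poly L K c x = (\<Sum>k\<in>K. c k * cis (phase L k x))"

lemma phase_add: "phase L (k + l) x = phase L k x + phase L l x"
  by (simp add: phase_def algebra_simps sum.distrib)

lemma phase_diff: "phase L (k - l) x = phase L k x - phase L l x"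
  by (simp add: phase_def algebra_simps sum_subtractf)

lemma phase_0 [simp]: "phase L 0 x = 0"
  by (simp add: phase_def)

lemma phase_shift: "phase L k (x + h *\<^sub>R axis i 1) = phase L k x + 2 * pi / L * h * of_int (k $ i)"
proof -
  have "(\<Sum>j\<in>UNIV. of_int (k $ j) * (h * axis i 1 $ j)) = h * of_int (k $ i)"
    by (simp add: axis_def if_distrib[of "\<lambda>t. _ * t"] cong: if_cong)
  thus ?thesis by (simp add: phase_def algebra_simps sum.distrib)
qed

lemma bounded_linear_phase: "bounded_linear (phase L k)"
proof -
  have "linear (phase L k)"
    by (rule linearI) (simp_all add: phase_def algebra_simps sum.distrib sum_distrib_left)
  thus ?thesis by (simp add: linear_conv_bounded_linear)
qed

lemma continuous_phase: "continuous_on A (phase L k)"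
  by (rule linear_continuous_on[OF bounded_linear_phase])

lemma phase_measurable [measurable]: "phase L k \<in> borel_measurable borel"
  by (rule borel_measurable_continuous_onI[OF continuous_phase])

context
  fixes L :: real
  assumes L: "L > 0"
begin

lemma cis_phase_period: "cis (phase L k (x + L *\<^sub>R axis i 1)) = cis (phase L k x)"
  using L cis_multiple_2pi[of "of_int (k $ i)"]
  by (simp add: phase_shift flip: cis_mult)

lemma cos_phase_period: "cos (phase L k (x + L *\<^sub>R axis i 1)) = cos (phase L k x)"
  using arg_cong[OF cis_phase_period, of Re] by simp

lemma sin_phase_period: "sin (phase L k (x + L *\<^sub>R axis i 1)) = sin (phase L k x)"
  using arg_cong[OF cis_phase_period, of Im] by simp

text \<open>
  A shift by half a wavelength reverses the sign of a nonconstant wave and preserves its integral.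
\<close>

lemma integral_wave_eq_0:
  assumes "k \<noteq> 0"
  shows "(\<integral>x. cos (phase L k x) \<partial>torus L) = 0" "(\<integral>x. sin (phase L k x) \<partial>torus L) = 0"
proof -
  obtain i where i: "k $ i \<noteq> 0" using assms by (auto simp: vec_eq_iff)
  define h where "h = L / (2 * \<bar>of_int (k $ i)\<bar>)"
  \<comment> \<open>half a wavelength in the direction \<open>i\<close>\<close>
  have k1: "\<bar>real_of_int (k $ i)\<bar> \<ge> 1" using i by linarith
  have h: "0 \<le> h" "h \<le> L" using L k1 by (auto simp: h_def field_simps)
  have ph: "phase L k (x + h *\<^sub>R axis i 1) = phase L k x + pi
      \<or> phase L k (x + h *\<^sub>R axis i 1) = phase L k x - pi" for x
  proof (cases "k $ i > 0")
    case True thus ?thesis using L by (simp add: phase_shift h_def)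
  next
    case False
    hence "2 * pi / L * h * of_int (k $ i) = - pi" using L i by (simp add: h_def field_simps)
    thus ?thesis by (simp only: phase_shift) simp
  qed
  have c: "cos (phase L k (x + h *\<^sub>R axis i 1)) = - cos (phase L k x)"
    and s: "sin (phase L k (x + h *\<^sub>R axis i 1)) = - sin (phase L k x)" for x
    using ph[of x] by (auto simp: cos_diff sin_diff)
  show "(\<integral>x. cos (phase L k x) \<partial>torus L) = 0"
    using integral_torus_shift[of "\<lambda>x. cos (phase L k x)" 1 L i h] h cos_phase_period
    by (simp add: c)
  show "(\<integral>x. sin (phase L k x) \<partial>torus L) = 0"
    using integral_torus_shift[of "\<lambda>x. sin (phase L k x)" 1 L i h] h sin_phase_period
    by (simp add: s)
qed

lemma integral_cos_phase:
  "(\<integral>x. cos (phase L k x) \<partial>torus L) = (if k = 0 then measure (torus L) (cell L) else 0)"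
  using integral_wave_eq_0(1)[of k] by simp

lemma integral_sin_phase: "(\<integral>x. sin (phase L k x) \<partial>torus L) = 0"
  using integral_wave_eq_0(2)[of k] by (cases "k = 0") simp_all

lemma integrable_torus_continuous:
  fixes f :: "real^3 \<Rightarrow> real"
  assumes "continuous_on UNIV f"
  shows "integrable (torus L) f"
  using integrable_mult_square_integrable[OF continuous_square_integrable_torus[OF assms, of L]
      continuous_square_integrable_torus[OF continuous_on_const, of 1 L]] by simp

text \<open>
  Parseval for a finite sum: the cross terms integrate nonconstant waves, because the product of one
  wave with the conjugate of another is the wave of the difference of their frequencies.
\<close>

lemma integral_trig_poly_norm_power2:
  assumes "finite K"
  shows "(\<integral>x. (cmod (trig_poly L K c x))\<^sup>2 \<partial>torus L)
           = measure (torus L) (cell L) * (\<Sum>k\<in>K. (cmod (c k))\<^sup>2)"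
proof -
  let ?a = "\<lambda>k l. c k * cnj (c l)"
  have pt: "(cmod (trig_poly L K c x))\<^sup>2
      = (\<Sum>k\<in>K. \<Sum>l\<in>K. Re (?a k l) * cos (phase L (k - l) x) - Im (?a k l) * sin (phase L (k - l) x))"
    for x
  proof -
    have "complex_of_real ((cmod (trig_poly L K c x))\<^sup>2)
        = trig_poly L K c x * cnj (trig_poly L K c x)"
      by (simp add: complex_mult_cnj cmod_power2)
    also have "\<dots> = (\<Sum>k\<in>K. \<Sum>l\<in>K. (c k * cis (phase L k x)) * (cnj (c l) * cis (- phase L l x)))"
      by (simp add: trig_poly_def sum_product cis_cnj)
    also have "\<dots> = (\<Sum>k\<in>K. \<Sum>l\<in>K. ?a k l * cis (phase L (k - l) x))"
      by (intro sum.cong refl) (simp add: phase_diff mult_ac cis_mult)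
    finally have "(cmod (trig_poly L K c x))\<^sup>2 = Re (\<Sum>k\<in>K. \<Sum>l\<in>K. ?a k l * cis (phase L (k - l) x))"
      by (metis Re_complex_of_real)
    thus ?thesis by (simp del: complex_cnj_mult add: Re_sum)
  qed
  have "(\<integral>x. (cmod (trig_poly L K c x))\<^sup>2 \<partial>torus L)
     = (\<Sum>k\<in>K. \<Sum>l\<in>K. \<integral>x. Re (?a k l) * cos (phase L (k - l) x)
          - Im (?a k l) * sin (phase L (k - l) x) \<partial>torus L)"
    unfolding pt
    by (subst Bochner_Integration.integral_sum
          | intro sum.cong refl integrable_torus_continuous continuous_intros continuous_phase)+
  also have "\<dots> = (\<Sum>k\<in>K. \<Sum>l\<in>K. if k = l then measure (torus L) (cell L) * (cmod (c k))\<^sup>2 else 0)"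
  proof (intro sum.cong refl)
    fix k l
    have "(\<integral>x. Re (?a k l) * cos (phase L (k - l) x) - Im (?a k l) * sin (phase L (k - l) x) \<partial>torus L)
      = Re (?a k l) * (\<integral>x. cos (phase L (k - l) x) \<partial>torus L) - Im (?a k l) * (\<integral>x. sin (phase L (k - l) x) \<partial>torus L)"
      by (subst Bochner_Integration.integral_diff)
         (auto intro!: integrable_torus_continuous continuous_intros continuous_phase)
    also have "\<dots> = (if k = l then measure (torus L) (cell L) * (cmod (c k))\<^sup>2 else 0)"
      by (simp only: integral_cos_phase integral_sin_phase) (auto simp: cmod_power2, simp add: power2_eq_square)
    finally show "(\<integral>x. Re (?a k l) * cos (phase L (k - l) x) - Im (?a k l) * sin (phase L (k - l) x) \<partial>torus L)
       = (if k = l then measure (torus L) (cell L) * (cmod (c k))\<^sup>2 else 0)" .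
  qed
  also have "\<dots> = measure (torus L) (cell L) * (\<Sum>k\<in>K. (cmod (c k))\<^sup>2)"
    using assms by (simp add: sum_distrib_left)
  finally show ?thesis .
qed

lemma Re_trig_poly:
  "Re (trig_poly L K c x) = (\<Sum>k\<in>K. Re (c k) * cos (phase L k x) - Im (c k) * sin (phase L k x))"
  by (simp add: trig_poly_def Re_sum)

lemma trig_poly_has_derivative:
  "((\<lambda>x. Re (trig_poly L K c x)) has_derivative
     (\<lambda>h. \<Sum>k\<in>K. - (Re (c k) * sin (phase L k x) + Im (c k) * cos (phase L k x)) * phase L k h)) (at x)"
  unfolding Re_trig_poly
  by (rule has_derivative_eq_rhs,
      (rule derivative_intros bounded_linear_imp_has_derivative[OF bounded_linear_phase])+,
      rule ext, intro sum.cong refl, simp add: algebra_simps)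

lemma partial_trig_poly:
  "partial i (\<lambda>x. Re (trig_poly L K c x))
     = (\<lambda>x. Re (trig_poly L K (\<lambda>k. \<i> * of_real (2 * pi / L * of_int (k $ i)) * c k) x))"
proof
  fix x
  have ax: "phase L k (axis i 1) = 2 * pi / L * of_int (k $ i)" for k
    using phase_shift[of L k 0 1 i] by (simp add: phase_def)
  have "partial i (\<lambda>x. Re (trig_poly L K c x)) x
     = (\<Sum>k\<in>K. - (Re (c k) * sin (phase L k x) + Im (c k) * cos (phase L k x)) * phase L k (axis i 1))"
    unfolding partial_def frechet_derivative_at[OF trig_poly_has_derivative, symmetric] ..
  also have "\<dots> = Re (trig_poly L K (\<lambda>k. \<i> * of_real (2 * pi / L * of_int (k $ i)) * c k) x)"
    unfolding Re_trig_poly ax by (intro sum.cong refl) (simp add: algebra_simps)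
  finally show "partial i (\<lambda>x. Re (trig_poly L K c x)) x
     = Re (trig_poly L K (\<lambda>k. \<i> * of_real (2 * pi / L * of_int (k $ i)) * c k) x)" .
qed

text \<open>
  All derivatives exist because differentiation only changes the coefficients.
\<close>

lemma Ck_trig_poly: "Ck n (\<lambda>x. Re (trig_poly L K c x))"
proof (induction n arbitrary: c)
  case 0
  show ?case unfolding Ck.simps Re_trig_poly by (intro continuous_intros continuous_phase)
next
  case (Suc n)
  have "(\<lambda>x. Re (trig_poly L K c x)) differentiable_on UNIV"
    unfolding differentiable_on_def differentiable_def using trig_poly_has_derivative by blast
  thus ?case using Suc by (simp add: partial_trig_poly)
qed

lemma trig_poly_test: "(\<lambda>x. Re (trig_poly L K c x)) \<in> torus_test L"
  using Ck_trig_poly by (simp add: torus_test_def torus_periodic_def Re_trig_poly cos_phase_period sin_phase_period)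

lemma trig_poly_square_integrable: "(\<lambda>x. Re (trig_poly L K c x)) \<in> square_integrable (torus L)"
  using Ck_trig_poly[of 0] by (simp add: continuous_square_integrable_torus)

text \<open>
  After removal of its constant term, a trigonometric polynomial is a divergence of trigonometric
  polynomials of controlled size: every nonzero frequency is integrated in a direction in which it
  does not vanish, hence has modulus at least \<open>2 \<pi> / L\<close>.  This is the Poincare inequality in dual
  form.
\<close>

lemma trig_poly_divergence:
  assumes K: "finite K"
  shows "\<exists>d. (\<forall>x. (\<Sum>i\<in>UNIV. partial i (\<lambda>y. Re (trig_poly L K (d i) y)) x)
                  = Re (trig_poly L K c x) - (if 0 \<in> K then Re (c 0) else 0)) \<and>
             (\<forall>i. L2_norm (torus L) (\<lambda>x. Re (trig_poly L K (d i) x))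
                  \<le> L / (2 * pi) * sqrt (\<integral>x. (cmod (trig_poly L K c x))\<^sup>2 \<partial>torus L))"
proof -
  \<comment> \<open>\<open>j k\<close> is the direction in which the frequency \<open>k\<close> is integrated.\<close>
  have "\<exists>j. \<forall>k::int^3. k \<noteq> 0 \<longrightarrow> k $ (j k) \<noteq> 0"
    by (rule choice) (metis vec_eq_iff zero_index)
  then obtain j :: "int^3 \<Rightarrow> 3" where j: "\<And>k. k \<noteq> 0 \<Longrightarrow> k $ j k \<noteq> 0" by blast
  define w where "w i k = 2 * pi / L * real_of_int (k $ i)" for i :: 3 and k :: "int^3"
  define d where "d i k = (if k \<noteq> 0 \<and> j k = i then c k / (\<i> * of_real (w i k)) else 0)" for i k
  have "(\<Sum>i\<in>UNIV. partial i (\<lambda>y. Re (trig_poly L K (d i) y)) x)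
          = Re (trig_poly L K c x) - (if 0 \<in> K then Re (c 0) else 0)" for x
  proof -
    have w0: "w (j k) k \<noteq> 0" if "k \<noteq> 0" for k using j[OF that] L by (simp add: w_def)
    have "(\<Sum>i\<in>UNIV. partial i (\<lambda>y. Re (trig_poly L K (d i) y)) x)
        = Re (\<Sum>i\<in>UNIV. \<Sum>k\<in>K. \<i> * of_real (w i k) * d i k * cis (phase L k x))"
      unfolding partial_trig_poly w_def by (simp only: trig_poly_def Re_sum)
    also have "(\<Sum>i\<in>UNIV. \<Sum>k\<in>K. \<i> * of_real (w i k) * d i k * cis (phase L k x))
        = (\<Sum>k\<in>K. \<Sum>i\<in>UNIV. \<i> * of_real (w i k) * d i k * cis (phase L k x))"
      by (rule sum.swap)
    also have "\<dots> = (\<Sum>k\<in>K. (if k = 0 then 0 else c k * cis (phase L k x)))"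
    proof (intro sum.cong refl)
      fix k
      have "(\<Sum>i\<in>UNIV. \<i> * of_real (w i k) * d i k * cis (phase L k x))
         = (\<Sum>i\<in>UNIV. if j k = i then (if k = 0 then 0 else c k * cis (phase L k x)) else 0)"
        by (intro sum.cong refl) (use w0 in \<open>auto simp: d_def\<close>)
      thus "(\<Sum>i\<in>UNIV. \<i> * of_real (w i k) * d i k * cis (phase L k x))
         = (if k = 0 then 0 else c k * cis (phase L k x))" by simp
    qed
    also have "\<dots> = (\<Sum>k\<in>K. c k * cis (phase L k x) - (if k = 0 then c 0 else 0))"
      by (intro sum.cong) auto
    also have "\<dots> = trig_poly L K c x - (if 0 \<in> K then c 0 else 0)"
      using K by (simp add: sum_subtractf trig_poly_def)
    finally show ?thesis by simp
  qed
  moreover have "L2_norm (torus L) (\<lambda>x. Re (trig_poly L K (d i) x))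
       \<le> L / (2 * pi) * sqrt (\<integral>x. (cmod (trig_poly L K c x))\<^sup>2 \<partial>torus L)" for i
  proof -
    have cont: "continuous_on UNIV (trig_poly L K c')" for c'
      unfolding trig_poly_def
      by (intro continuous_intros continuous_on_compose2[OF continuous_on_cis] continuous_phase)
    have d: "(cmod (d i k))\<^sup>2 \<le> (L / (2 * pi))\<^sup>2 * (cmod (c k))\<^sup>2" for k
    proof (cases "k \<noteq> 0 \<and> j k = i")
      case True
      have "k $ i \<noteq> 0" using True j[of k] by auto
      hence "\<bar>real_of_int (k $ i)\<bar> \<ge> 1" by linarith
      hence "2 * pi / L * 1 \<le> \<bar>w i k\<bar>"
        unfolding w_def abs_mult using L by (intro mult_mono) auto
      moreover have "0 < 2 * pi / L" using L by simp
      ultimately have "cmod (c k) / \<bar>w i k\<bar> \<le> cmod (c k) / (2 * pi / L)"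
        by (intro divide_left_mono mult_pos_pos) auto
      hence "cmod (d i k) \<le> L / (2 * pi) * cmod (c k)"
        using True by (simp add: d_def norm_divide norm_mult field_simps)
      hence "(cmod (d i k))\<^sup>2 \<le> (L / (2 * pi) * cmod (c k))\<^sup>2" by (intro power_mono) auto
      thus ?thesis by (simp add: power_mult_distrib power_divide)
    next
      case False thus ?thesis unfolding d_def by auto
    qed
    have "(L2_norm (torus L) (\<lambda>x. Re (trig_poly L K (d i) x)))\<^sup>2
        \<le> (\<integral>x. (cmod (trig_poly L K (d i) x))\<^sup>2 \<partial>torus L)"
      unfolding L2_norm_power2
      by (intro integral_mono integrable_torus_continuous continuous_intros cont)
         (simp add: cmod_power2)
    also have "\<dots> \<le> (L / (2 * pi))\<^sup>2 * (\<integral>x. (cmod (trig_poly L K c x))\<^sup>2 \<partial>torus L)"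
    proof -
      have "(\<Sum>k\<in>K. (cmod (d i k))\<^sup>2) \<le> (L / (2 * pi))\<^sup>2 * (\<Sum>k\<in>K. (cmod (c k))\<^sup>2)"
        unfolding sum_distrib_left by (intro sum_mono d)
      from mult_left_mono[OF this, of "measure (torus L) (cell L)"] show ?thesis
        by (simp add: integral_trig_poly_norm_power2[OF K] mult_ac)
    qed
    finally have "sqrt ((L2_norm (torus L) (\<lambda>x. Re (trig_poly L K (d i) x)))\<^sup>2)
       \<le> sqrt ((L / (2 * pi))\<^sup>2 * (\<integral>x. (cmod (trig_poly L K c x))\<^sup>2 \<partial>torus L))"
      by (rule real_sqrt_le_mono)
    thus ?thesis using L by (simp add: real_sqrt_mult)
  qed
  ultimately show ?thesis by blast
qed

end

section \<open>Density of trigonometric polynomials\<close>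

definition is_trig_poly :: "real \<Rightarrow> (real^3 \<Rightarrow> complex) \<Rightarrow> bool" where
  "is_trig_poly L F \<longleftrightarrow> (\<exists>K c. finite K \<and> F = trig_poly L K c)"

lemma is_trig_poly_wave: "is_trig_poly L (\<lambda>x. z * cis (phase L k x))"
  unfolding is_trig_poly_def
  by (intro exI[of _ "{k}"] exI[of _ "\<lambda>_. z"]) (auto simp: trig_poly_def)

lemma is_trig_poly_const: "is_trig_poly L (\<lambda>x. z)"
  using is_trig_poly_wave[of L z 0] by simp

lemma is_trig_poly_add:
  assumes "is_trig_poly L F" "is_trig_poly L G"
  shows "is_trig_poly L (\<lambda>x. F x + G x)"
proof -
  obtain K c where K: "finite K" "F = trig_poly L K c" using assms by (auto simp: is_trig_poly_def)
  obtain K' c' where K': "finite K'" "G = trig_poly L K' c'" using assms by (auto simp: is_trig_poly_def)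
  define d where "d k = (if k \<in> K then c k else 0) + (if k \<in> K' then c' k else 0)" for k
  have "F x + G x = trig_poly L (K \<union> K') d x" for x
  proof -
    have "F x = (\<Sum>k\<in>K\<union>K'. (if k \<in> K then c k else 0) * cis (phase L k x))"
      unfolding K trig_poly_def by (rule sum.mono_neutral_cong_left) (use K K' in auto)
    moreover have "G x = (\<Sum>k\<in>K\<union>K'. (if k \<in> K' then c' k else 0) * cis (phase L k x))"
      unfolding K' trig_poly_def by (rule sum.mono_neutral_cong_left) (use K K' in auto)
    ultimately show ?thesis by (simp add: trig_poly_def d_def sum.distrib distrib_right)
  qed
  thus ?thesis unfolding is_trig_poly_def using K K' by blast
qed

lemma is_trig_poly_sum:
  assumes "\<And>i. i \<in> I \<Longrightarrow> is_trig_poly L (F i)"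
  shows "is_trig_poly L (\<lambda>x. \<Sum>i\<in>I. F i x)"
  using assms
  by (induction I rule: infinite_finite_induct) (auto intro: is_trig_poly_const is_trig_poly_add)

lemma is_trig_poly_mult:
  assumes "is_trig_poly L F" "is_trig_poly L G"
  shows "is_trig_poly L (\<lambda>x. F x * G x)"
proof -
  obtain K c where K: "F = trig_poly L K c" using assms by (auto simp: is_trig_poly_def)
  obtain K' c' where K': "G = trig_poly L K' c'" using assms by (auto simp: is_trig_poly_def)
  have "(\<lambda>x. F x * G x) = (\<lambda>x. \<Sum>k\<in>K. \<Sum>l\<in>K'. (c k * c' l) * cis (phase L (k + l) x))"
    unfolding K K' trig_poly_def sum_product
    by (intro ext sum.cong refl) (simp add: phase_add mult_ac flip: cis_mult)
  thus ?thesis by (simp only:) (intro is_trig_poly_sum is_trig_poly_wave)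
qed

text \<open>
  The image of the closed cell is a compact set on which the Stone--Weierstrass theorem applies:
  trigonometric polynomials do not separate opposite faces of the cell, but polynomials separate the
  points of the image, and they pull back to trigonometric polynomials.
\<close>

definition torus_embedding :: "real \<Rightarrow> real^3 \<Rightarrow> complex^3" where
  "torus_embedding L x = (\<chi> i. cis (2 * pi / L * x $ i))"

lemma phase_axis: "phase L (axis i 1) x = 2 * pi / L * x $ i"
proof -
  have "(\<Sum>j\<in>UNIV. of_int (axis i 1 $ j) * x $ j) = (\<Sum>j\<in>UNIV. if j = i then x $ j else 0)"
    by (intro sum.cong) (auto simp: axis_def)
  thus ?thesis by (simp add: phase_def)
qed

lemma is_trig_poly_cos_sin:
  "is_trig_poly L (\<lambda>x. of_real (cos (2 * pi / L * x $ i)))"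
  "is_trig_poly L (\<lambda>x. of_real (sin (2 * pi / L * x $ i)))"
proof -
  have m: "phase L (- k) x = - phase L k x" for k x using phase_diff[of L 0 k x] by simp
  have c: "complex_of_real (cos t) = 1/2 * cis t + 1/2 * cis (- t)"
    and s: "complex_of_real (sin t) = - \<i>/2 * cis t + \<i>/2 * cis (- t)" for t
    by (simp_all add: complex_eq_iff)
  show "is_trig_poly L (\<lambda>x. of_real (cos (2 * pi / L * x $ i)))"
    unfolding c phase_axis [symmetric] m [symmetric]
    by (intro is_trig_poly_add is_trig_poly_wave)
  show "is_trig_poly L (\<lambda>x. of_real (sin (2 * pi / L * x $ i)))"
    unfolding s phase_axis [symmetric] m [symmetric]
    by (intro is_trig_poly_add is_trig_poly_wave)
qed

lemma is_trig_poly_polynomial: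
  assumes "real_polynomial_function p"
  shows "is_trig_poly L (\<lambda>x. of_real (p (torus_embedding L x)))"
  using assms
proof induction
  case (linear f)
  then interpret bounded_linear f .
  have "f (torus_embedding L x) = (\<Sum>i\<in>UNIV. cos (2 * pi / L * x $ i) * f (axis i 1)
      + sin (2 * pi / L * x $ i) * f (axis i \<i>))" for x
  proof -
    have "torus_embedding L x = (\<Sum>i\<in>UNIV. cos (2 * pi / L * x $ i) *\<^sub>R axis i 1
        + sin (2 * pi / L * x $ i) *\<^sub>R axis i \<i>)"
    proof (rule vec_eq_iff [THEN iffD2], rule allI)
      fix j
      have "(\<Sum>i\<in>UNIV. cos (2 * pi / L * x $ i) *\<^sub>R axis i 1 + sin (2 * pi / L * x $ i) *\<^sub>R axis i \<i>) $ j
        = (\<Sum>i\<in>UNIV. if i = j then cis (2 * pi / L * x $ j) else 0)"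
        unfolding sum_component
        by (intro sum.cong refl) (auto simp: axis_def complex_eq_iff)
      thus "torus_embedding L x $ j = (\<Sum>i\<in>UNIV. cos (2 * pi / L * x $ i) *\<^sub>R axis i 1
        + sin (2 * pi / L * x $ i) *\<^sub>R axis i \<i>) $ j"
        by (simp add: torus_embedding_def)
    qed
    thus ?thesis by (simp add: sum add scale)
  qed
  thus ?case
    by (simp only: of_real_sum of_real_add of_real_mult)
       (intro is_trig_poly_sum is_trig_poly_add is_trig_poly_mult is_trig_poly_cos_sin is_trig_poly_const)
qed (auto intro: is_trig_poly_const is_trig_poly_add is_trig_poly_mult)

lemma continuous_torus_embedding: "continuous_on A (torus_embedding L)"
  unfolding torus_embedding_def
  by (intro continuous_intros continuous_on_compose2[OF continuous_on_cis]) auto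

context
  fixes L :: real
  assumes L: "L > 0"
begin

lemma torus_embedding_eq_imp:
  assumes "x \<in> cbox 0 (\<chi> i. L)" "y \<in> cbox 0 (\<chi> i. L)" "torus_embedding L x = torus_embedding L y"
  shows "x $ i = y $ i \<or> x $ i = 0 \<and> y $ i = L \<or> x $ i = L \<and> y $ i = 0"
proof -
  have b: "0 \<le> x $ i" "x $ i \<le> L" "0 \<le> y $ i" "y $ i \<le> L"
    using assms(1,2) by (auto simp: mem_box_cart)
  have "cis (2 * pi / L * x $ i) = cis (2 * pi / L * y $ i)"
    using arg_cong[OF assms(3), of "\<lambda>z. z $ i"] by (simp add: torus_embedding_def)
  hence "cis (2 * pi / L * x $ i - 2 * pi / L * y $ i) = 1"
    by (simp flip: cis_divide)
  hence "cos (2 * pi / L * x $ i - 2 * pi / L * y $ i) = 1"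
    by (metis cis.simps(1) one_complex.simps(1))
  then obtain n :: int where n: "2 * pi / L * x $ i - 2 * pi / L * y $ i = n * 2 * pi"
    by (auto simp: cos_one_2pi_int)
  hence "(2 * pi) * (x $ i - y $ i) = (2 * pi) * (n * L)" using L by (simp add: field_simps)
  hence e: "x $ i - y $ i = n * L" by simp
  have "\<bar>n * L\<bar> \<le> 1 * L" unfolding e [symmetric] using b by linarith
  hence "\<bar>real_of_int n\<bar> \<le> 1" using L by (simp add: abs_mult)
  hence "n = -1 \<or> n = 0 \<or> n = 1" by linarith
  thus ?thesis using e b by auto
qed

text \<open>
  A function vanishing on the boundary of the closed cell descends to the
  torus; its quotient is continuous because its graph is compact, and the quotient is approximated by
  polynomials.
\<close>

lemma trig_poly_uniform_approx:
  fixes w :: "real^3 \<Rightarrow> real"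
  assumes cont: "continuous_on (cbox 0 (\<chi> i. L)) w"
    and bdry: "\<And>x i. x \<in> cbox 0 (\<chi> i. L) \<Longrightarrow> x $ i = 0 \<or> x $ i = L \<Longrightarrow> w x = 0"
    and e: "e > 0"
  shows "\<exists>K c. finite K \<and> (\<forall>x. Im (trig_poly L K c x) = 0) \<and>
           (\<forall>x\<in>cbox 0 (\<chi> i. L). \<bar>w x - Re (trig_poly L K c x)\<bar> < e)"
proof -
  let ?Q = "cbox 0 (\<chi> i. L) :: (real^3) set"
  \<comment> \<open>the function induced on the image; it does not depend on the chosen preimage\<close>
  define G where "G z = w (SOME x. x \<in> ?Q \<and> torus_embedding L x = z)" for z
  have G: "G (torus_embedding L x) = w x" if x: "x \<in> ?Q" for x
  proof -
    define y where "y = (SOME y. y \<in> ?Q \<and> torus_embedding L y = torus_embedding L x)"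
    have "y \<in> ?Q \<and> torus_embedding L y = torus_embedding L x"
      unfolding y_def by (rule someI[of _ x]) (use x in simp)
    hence y: "y \<in> ?Q" "torus_embedding L y = torus_embedding L x" by auto
    have "w y = w x"
    proof (cases "x = y")
      case False
      then obtain i where "x $ i \<noteq> y $ i" by (auto simp: vec_eq_iff)
      hence "x $ i = 0 \<and> y $ i = L \<or> x $ i = L \<and> y $ i = 0"
        using torus_embedding_eq_imp[OF x y(1) y(2)[symmetric], of i] by blast
      thus ?thesis using bdry[OF x, of i] bdry[OF y(1), of i] by auto
    qed simp
    thus ?thesis by (simp add: G_def y_def)
  qed
  let ?S = "torus_embedding L ` ?Q"
  have cS: "compact ?S"
    by (intro compact_continuous_image continuous_torus_embedding compact_cbox)
  have cT: "compact (w ` ?Q)" by (intro compact_continuous_image cont compact_cbox)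
  have "continuous_on ?S G"
  proof (subst continuous_closed_graph_eq[OF cT])
    show "G \<in> ?S \<rightarrow> w ` ?Q" using G by auto
    have "(\<lambda>z. (z, G z)) ` ?S = (\<lambda>x. (torus_embedding L x, w x)) ` ?Q"
      using G by (auto simp: image_iff)
    moreover have "compact ((\<lambda>x. (torus_embedding L x, w x)) ` ?Q)"
      by (intro compact_continuous_image continuous_intros continuous_torus_embedding cont compact_cbox)
    ultimately show "closedin (top_of_set (?S \<times> w ` ?Q)) ((\<lambda>z. (z, G z)) ` ?S)"
      using G by (intro closed_subset) (auto dest: compact_imp_closed)
  qed
  then obtain p where p: "real_polynomial_function p" "\<And>z. z \<in> ?S \<Longrightarrow> \<bar>G z - p z\<bar> < e"
    using Stone_Weierstrass_real_polynomial_function[OF cS _ e] by blast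
  obtain K c where K: "finite K" "(\<lambda>x. complex_of_real (p (torus_embedding L x))) = trig_poly L K c"
    using is_trig_poly_polynomial[OF p(1), of L] unfolding is_trig_poly_def by blast
  have "trig_poly L K c x = of_real (p (torus_embedding L x))" for x
    using fun_cong[OF K(2), of x] by simp
  moreover have "\<bar>w x - p (torus_embedding L x)\<bar> < e" if "x \<in> ?Q" for x
    using p(2)[OF imageI[OF that]] G[OF that] by simp
  ultimately show ?thesis using K(1) by (intro exI[of _ K] exI[of _ c]) auto
qed

text \<open>
  A measurable function is an almost everywhere limit of continuous functions; clamping them
  provides a dominating constant, and a cutoff that increases to \<open>1\<close> in the interior of the cell
  provides the boundary values.
\<close>

lemma continuous_vanishing_approx:
  assumes v: "v \<in> borel_measurable (torus L)" and B: "\<And>x. \<bar>v x\<bar> \<le> B"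
  shows "\<exists>w. (\<forall>n. continuous_on UNIV (w n)) \<and>
           (\<forall>n x i. x $ i = 0 \<or> x $ i = L \<longrightarrow> w n x = 0) \<and>
           (\<lambda>n. L2_norm (torus L) (\<lambda>x. w n x - v x)) \<longlonglongrightarrow> 0"
proof -
  have "v measurable_on cell L"
    unfolding measurable_on_iff_borel_measurable[OF cell_lebesgue] using v by (simp add: torus_eq)
  then obtain N g where N: "negligible N" and g: "\<And>n. continuous_on UNIV (g n)"
    and lim: "\<And>x. x \<notin> N \<Longrightarrow> (\<lambda>n. g n x) \<longlonglongrightarrow> (if x \<in> cell L then v x else 0)"
    unfolding measurable_on_def by blast
  have B0: "B \<ge> 0" using B[of 0] by linarith
  \<comment> \<open>\<open>\<rho>\<close> is positive exactly in the interior of the cell.\<close>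
  define \<rho> where "\<rho> x = (\<Prod>i\<in>UNIV. max 0 (x $ i * (L - x $ i)))" for x :: "real^3"
  define \<eta> where "\<eta> n x = min 1 (real n * \<rho> x)" for n x
  define w where "w n x = \<eta> n x * max (- B) (min B (g n x))" for n x
  have \<rho>0: "\<rho> x \<ge> 0" for x unfolding \<rho>_def by (intro prod_nonneg) auto
  have \<eta>: "0 \<le> \<eta> n x" "\<eta> n x \<le> 1" for n x using \<rho>0 by (auto simp: \<eta>_def)
  have cw: "continuous_on UNIV (w n)" for n
    unfolding w_def \<eta>_def \<rho>_def by (intro continuous_intros g)
  have bw: "\<bar>w n x\<bar> \<le> B" for n x
  proof -
    have "\<bar>max (- B) (min B (g n x))\<bar> \<le> B" using B0 by auto
    hence "\<eta> n x * \<bar>max (- B) (min B (g n x))\<bar> \<le> 1 * B" using \<eta> by (intro mult_mono) auto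
    thus ?thesis using \<eta>[of n x] by (simp add: w_def abs_mult)
  qed
  have zero: "w n x = 0" if "x $ i = 0 \<or> x $ i = L" for n x i
  proof -
    have "\<rho> x = 0" unfolding \<rho>_def by (rule prod_zero) (use that in \<open>auto intro!: exI[of _ i]\<close>)
    thus ?thesis by (simp add: w_def \<eta>_def)
  qed
  have neg: "negligible (N \<union> (\<Union>i. {x. x $ i = 0}))"
    by (intro negligible_Un N negligible_Union) (auto intro: negligible_standard_hyperplane_cart)
  have conv: "(\<lambda>n. w n x) \<longlonglongrightarrow> v x" if x: "x \<in> cell L" "x \<notin> N \<union> (\<Union>i. {x. x $ i = 0})" for x
  proof -
    have pos: "0 < x $ i * (L - x $ i)" for i
      using x by (intro mult_pos_pos) (auto simp: cell_def less_le)
    have "\<rho> x > 0" unfolding \<rho>_def by (intro prod_pos) (use pos in \<open>auto simp: less_max_iff_disj\<close>)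
    hence "filterlim (\<lambda>n. real n * \<rho> x) at_top sequentially"
      by (intro filterlim_at_top_mult_tendsto_pos[OF tendsto_const] filterlim_real_sequentially)
    hence "eventually (\<lambda>n. real n * \<rho> x \<ge> 1) sequentially"
      by (simp add: filterlim_at_top)
    hence "eventually (\<lambda>n. \<eta> n x = 1) sequentially"
      by eventually_elim (simp add: \<eta>_def)
    hence "(\<lambda>n. \<eta> n x) \<longlonglongrightarrow> 1" by (rule tendsto_eventually)
    moreover have "(\<lambda>n. g n x) \<longlonglongrightarrow> v x" using lim[of x] x by simp
    ultimately have "(\<lambda>n. w n x) \<longlonglongrightarrow> 1 * max (- B) (min B (v x))"
      unfolding w_def by (intro tendsto_intros)
    thus ?thesis using B[of x] by (simp add: min_def max_def abs_le_iff split: if_splits)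
  qed
  have "(\<lambda>n. L2_norm (torus L) (\<lambda>x. w n x - v x)) \<longlonglongrightarrow> 0"
  proof (rule L2_norm_tendsto_0_dominated[OF finite_measure_torus continuous_measurable_torus v])
    show "AE x in torus L. (\<lambda>n. w n x) \<longlonglongrightarrow> v x"
      unfolding torus_eq
    proof (subst AE_restrict_space_iff)
      show "cell L \<inter> space lebesgue \<in> sets lebesgue" using cell_lebesgue by simp
      show "AE x in lebesgue. x \<in> cell L \<longrightarrow> (\<lambda>n. w n x) \<longlonglongrightarrow> v x"
        by (rule AE_I'[OF neg[unfolded negligible_iff_null_sets]]) (use conv in auto)
    qed
    show "(\<lambda>x. 2 * B) \<in> square_integrable (torus L)"
      by (intro continuous_square_integrable_torus continuous_intros)
    show "AE x in torus L. \<bar>w n x - v x\<bar> \<le> 2 * B" for n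
      using bw[of n] B by (intro AE_I2) (smt (verit))
  qed (rule cw)
  thus ?thesis using cw zero by blast
qed

lemma L2_norm_le_bound:
  assumes "u \<in> square_integrable (torus L)" "\<And>x. x \<in> cell L \<Longrightarrow> \<bar>u x\<bar> \<le> d" "d \<ge> 0"
  shows "L2_norm (torus L) u \<le> d * sqrt (measure (torus L) (cell L))"
proof -
  interpret finite_measure "torus L" by (rule finite_measure_torus)
  have "(\<integral>x. (u x)\<^sup>2 \<partial>torus L) \<le> (\<integral>x. d\<^sup>2 \<partial>torus L)"
    using assms
    by (intro integral_mono square_integrableD)
       (auto simp: abs_le_square_iff [symmetric]
         intro!: continuous_square_integrable_torus continuous_on_const)
  hence "L2_norm (torus L) u \<le> sqrt (d\<^sup>2 * measure (torus L) (cell L))"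
    unfolding L2_norm_def by (intro real_sqrt_le_mono) (simp add: mult.commute)
  thus ?thesis using assms(3) by (simp add: real_sqrt_mult)
qed

text \<open>
  Truncate, replace the truncation by continuous functions vanishing on the
  boundary of the cell, and approximate these uniformly.
  The approximants are real valued, so that their complex \<open>L\<^sup>2\<close> norm, which Parseval computes, is the
  norm of their real parts.
\<close>

lemma trig_poly_dense:
  assumes u: "u \<in> square_integrable (torus L)" and e: "e > 0"
  shows "\<exists>K c. finite K \<and> (\<forall>x. Im (trig_poly L K c x) = 0) \<and>
           L2_norm (torus L) (\<lambda>x. u x - Re (trig_poly L K c x)) < e"
proof -
  note [measurable] = square_integrableD(1)[OF u]
  define v where "v n x = max (- real n) (min (real n) (u x))" for n x
  have vm [measurable]: "v n \<in> borel_measurable (torus L)" for n unfolding v_def by measurable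
  have "(\<lambda>n. L2_norm (torus L) (\<lambda>x. v n x - u x)) \<longlonglongrightarrow> 0"
  proof (rule L2_norm_tendsto_0_dominated[OF finite_measure_torus])
    show "(\<lambda>x. \<bar>u x\<bar>) \<in> square_integrable (torus L)" using u by (auto simp: square_integrable_def)
    show "AE x in torus L. \<bar>v n x - u x\<bar> \<le> \<bar>u x\<bar>" for n
      by (intro AE_I2) (auto simp: v_def)
    show "AE x in torus L. (\<lambda>n. v n x) \<longlonglongrightarrow> u x"
    proof (rule AE_I2)
      fix x
      obtain m where m: "\<bar>u x\<bar> \<le> real m" using real_arch_simple by blast
      have "eventually (\<lambda>n. v n x = u x) sequentially"
        by (rule eventually_sequentiallyI[of m]) (use m in \<open>auto simp: v_def\<close>)
      thus "(\<lambda>n. v n x) \<longlonglongrightarrow> u x" by (rule tendsto_eventually)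
    qed
  qed measurable
  from order_tendstoD(2)[OF this, of "e/3"] e obtain n
    where n: "L2_norm (torus L) (\<lambda>x. v n x - u x) < e / 3"
    by (auto simp: eventually_sequentially)
  have vb: "\<bar>v n x\<bar> \<le> real n" for x by (auto simp: v_def)
  have vL2: "v n \<in> square_integrable (torus L)"
    by (rule square_integrable_bounded[OF finite_measure_torus vm]) (use vb in auto)
  obtain W where W: "\<And>m. continuous_on UNIV (W m)" "\<And>m x i. x $ i = 0 \<or> x $ i = L \<Longrightarrow> W m x = 0"
    "(\<lambda>m. L2_norm (torus L) (\<lambda>x. W m x - v n x)) \<longlonglongrightarrow> 0"
    using continuous_vanishing_approx[OF vm vb] by blast
  from order_tendstoD(2)[OF W(3), of "e/3"] e obtain m
    where m: "L2_norm (torus L) (\<lambda>x. W m x - v n x) < e / 3"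
    by (auto simp: eventually_sequentially)
  define s where "s = sqrt (measure (torus L) (cell L))"
  have s: "s \<ge> 0" by (simp add: s_def)
  define d where "d = e / (3 * (s + 1))"
  have d: "d > 0" "d * s < e / 3" using e s by (auto simp: d_def field_simps)
  have "\<exists>K c. finite K \<and> (\<forall>x. Im (trig_poly L K c x) = 0) \<and>
      (\<forall>x\<in>cbox 0 (\<chi> i. L). \<bar>W m x - Re (trig_poly L K c x)\<bar> < d)"
  proof (rule trig_poly_uniform_approx[OF _ _ d(1)])
    show "continuous_on (cbox 0 (\<chi> i. L)) (W m)"
      by (rule continuous_on_subset[OF W(1)]) simp
  qed (rule W(2))
  then obtain K c where K: "finite K" "\<And>x. Im (trig_poly L K c x) = 0"
     "\<And>x. x \<in> cbox 0 (\<chi> i. L) \<Longrightarrow> \<bar>W m x - Re (trig_poly L K c x)\<bar> < d"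
    by blast
  have WL2: "W m \<in> square_integrable (torus L)" by (rule continuous_square_integrable_torus[OF W(1)])
  note TL2 = trig_poly_square_integrable[OF L, of K c]
  have "L2_norm (torus L) (\<lambda>x. W m x - Re (trig_poly L K c x)) \<le> d * s"
    unfolding s_def
    by (rule L2_norm_le_bound)
       (use d(1) K(3) cell_subset_cbox[of L] in
         \<open>auto intro!: square_integrable_diff WL2 TL2 less_imp_le\<close>)
  hence "L2_norm (torus L) (\<lambda>x. u x - Re (trig_poly L K c x)) < e"
    using L2_norm_triangle_diff[OF u vL2 TL2] L2_norm_triangle_diff[OF vL2 WL2 TL2] n m d(2)
      L2_norm_commute[of "torus L" u "v n"] L2_norm_commute[of "torus L" "v n" "W m"] by linarith
  thus ?thesis using K by blast
qed

end

section \<open>Weak derivatives and the Poincare inequality\<close>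

lemma torus_test_square_integrable:
  assumes "f \<in> torus_test L"
  shows "f \<in> square_integrable (torus L)" "partial i f \<in> square_integrable (torus L)"
proof -
  have "Ck 0 f" "Ck 1 f" using assms by (auto simp: torus_test_def)
  thus "f \<in> square_integrable (torus L)" "partial i f \<in> square_integrable (torus L)"
    by (auto intro!: continuous_square_integrable_torus)
qed

lemma has_weak_partialD:
  assumes "has_weak_partial L i u g"
  shows "g \<in> square_integrable (torus L)" "torus_periodic L g"
    "f \<in> torus_test L \<Longrightarrow> (\<integral>x. u x * partial i f x \<partial>torus L) = - (\<integral>x. g x * f x \<partial>torus L)"
  using assms by (auto simp: has_weak_partial_def torus_L2_iff)

lemma integral_lincomb_mult:
  assumes "u \<in> square_integrable M" "v \<in> square_integrable M" "f \<in> square_integrable M"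
  shows "(\<integral>x. (a * u x + b * v x) * f x \<partial>M) = a * (\<integral>x. u x * f x \<partial>M) + b * (\<integral>x. v x * f x \<partial>M)"
proof -
  have "(\<integral>x. (a * u x + b * v x) * f x \<partial>M) = (\<integral>x. a * (u x * f x) + b * (v x * f x) \<partial>M)"
    by (simp add: algebra_simps)
  also have "\<dots> = (\<integral>x. a * (u x * f x) \<partial>M) + (\<integral>x. b * (v x * f x) \<partial>M)"
    using assms
    by (intro Bochner_Integration.integral_add integrable_mult_right integrable_mult_square_integrable)
  finally show ?thesis by simp
qed

lemma square_integrable_lincomb:
  assumes "u \<in> square_integrable M" "v \<in> square_integrable M"
  shows "(\<lambda>x. a * u x + b * v x) \<in> square_integrable M"
  using assms by (intro square_integrable_add square_integrable_cmult)

lemma has_weak_partial_lincomb: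
  assumes "u \<in> square_integrable (torus L)" "v \<in> square_integrable (torus L)"
    and "has_weak_partial L i u g" "has_weak_partial L i v h"
  shows "has_weak_partial L i (\<lambda>x. a * u x + b * v x) (\<lambda>x. a * g x + b * h x)"
  unfolding has_weak_partial_def torus_L2_iff
proof (intro conjI ballI)
  note g = has_weak_partialD[OF assms(3)] and h = has_weak_partialD[OF assms(4)]
  show "torus_periodic L (\<lambda>x. a * g x + b * h x)"
    using g(2) h(2) by (simp add: torus_periodic_def)
  show "(\<lambda>x. a * g x + b * h x) \<in> square_integrable (torus L)"
    by (intro square_integrable_lincomb g h)
  fix f assume f: "f \<in> torus_test L"
  note ff = torus_test_square_integrable[OF f]
  show "(\<integral>x. (a * u x + b * v x) * partial i f x \<partial>torus L)
      = - (\<integral>x. (a * g x + b * h x) * f x \<partial>torus L)"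
    unfolding integral_lincomb_mult[OF assms(1,2) ff(2)] integral_lincomb_mult[OF g(1) h(1) ff(1)]
      g(3)[OF f] h(3)[OF f] by (simp add: algebra_simps)
qed

lemma tendsto_integral_mult:
  assumes "\<And>n. f n \<in> square_integrable M" "u \<in> square_integrable M" "v \<in> square_integrable M"
    and "(\<lambda>n. L2_norm M (\<lambda>x. f n x - u x)) \<longlonglongrightarrow> 0"
  shows "(\<lambda>n. \<integral>x. f n x * v x \<partial>M) \<longlonglongrightarrow> (\<integral>x. u x * v x \<partial>M)"
proof -
  have "(\<lambda>n. (\<integral>x. f n x * v x \<partial>M) - (\<integral>x. u x * v x \<partial>M)) \<longlonglongrightarrow> 0"
  proof (rule Lim_null_comparison)
    show "(\<lambda>n. L2_norm M (\<lambda>x. f n x - u x) * L2_norm M v) \<longlonglongrightarrow> 0"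
      using tendsto_mult_right[OF assms(4), of "L2_norm M v"] by simp
    have "(\<integral>x. f n x * v x \<partial>M) - (\<integral>x. u x * v x \<partial>M) = (\<integral>x. (f n x - u x) * v x \<partial>M)" for n
      using integral_lincomb_mult[OF assms(1)[of n] assms(2,3), of 1 "-1"] by simp
    thus "\<forall>\<^sub>F n in sequentially. norm ((\<integral>x. f n x * v x \<partial>M) - (\<integral>x. u x * v x \<partial>M))
        \<le> L2_norm M (\<lambda>x. f n x - u x) * L2_norm M v"
      using Cauchy_Schwarz_integral[OF square_integrable_diff[OF assms(1,2)] assms(3)] by simp
  qed
  thus ?thesis by (simp add: LIM_zero_iff)
qed

lemma torus_periodic_lim:
  assumes "\<And>n. torus_periodic L (f n)"
  shows "torus_periodic L (\<lambda>x. lim (\<lambda>n. f n x))"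
  using assms by (simp add: torus_periodic_def)

lemma torus_L2_complete:
  assumes f: "\<And>n. f n \<in> torus_L2 L"
    and "\<And>e. e > 0 \<Longrightarrow> \<exists>N. \<forall>m\<ge>N. \<forall>n\<ge>N. L2_norm (torus L) (\<lambda>x. f m x - f n x) < e"
  shows "\<exists>u\<in>torus_L2 L. (\<lambda>n. L2_norm (torus L) (\<lambda>x. f n x - u x)) \<longlonglongrightarrow> 0"
proof -
  obtain r :: "nat \<Rightarrow> nat" where r: "(\<lambda>x. lim (\<lambda>n. f (r n) x)) \<in> square_integrable (torus L)"
    "(\<lambda>n. L2_norm (torus L) (\<lambda>x. f n x - lim (\<lambda>n. f (r n) x))) \<longlonglongrightarrow> 0"
    using L2_complete[OF finite_measure_torus _ assms(2)] f by (auto simp: torus_L2_iff)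
  have "torus_periodic L (\<lambda>x. lim (\<lambda>n. f (r n) x))"
    by (rule torus_periodic_lim) (use f in \<open>auto simp: torus_L2_iff\<close>)
  thus ?thesis using r by (intro bexI[of _ "\<lambda>x. lim (\<lambda>n. f (r n) x)"]) (auto simp: torus_L2_iff)
qed

lemma H1_mean_zeroD:
  assumes "u \<in> H1_mean_zero L"
  shows "torus_periodic L u" "u \<in> square_integrable (torus L)" "(\<integral>x. u x \<partial>torus L) = 0"
    "has_weak_partial L i u (weak_partial L i u)"
  using assms someI_ex[of "has_weak_partial L i u"] unfolding H1_mean_zero_def weak_partial_def
  by (auto simp: torus_L2_iff)

lemma weak_partial_square_integrable:
  "u \<in> H1_mean_zero L \<Longrightarrow> weak_partial L i u \<in> square_integrable (torus L)"
  by (rule has_weak_partialD(1)[OF H1_mean_zeroD(4)])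

lemma H1_mean_zero_lincomb:
  assumes "u \<in> H1_mean_zero L" "v \<in> H1_mean_zero L"
  shows "(\<lambda>x. a * u x + b * v x) \<in> H1_mean_zero L"
proof -
  note u = H1_mean_zeroD[OF assms(1)] and v = H1_mean_zeroD[OF assms(2)]
  have one: "(\<lambda>x. 1) \<in> square_integrable (torus L)"
    by (intro continuous_square_integrable_torus continuous_intros)
  have "(\<integral>x. a * u x + b * v x \<partial>torus L) = 0"
    using integral_lincomb_mult[OF u(2) v(2) one, of a b] u(3) v(3) by simp
  moreover have "torus_periodic L (\<lambda>x. a * u x + b * v x)"
    using u(1) v(1) by (simp add: torus_periodic_def)
  ultimately show ?thesis
    using has_weak_partial_lincomb[OF u(2) v(2) u(4) v(4)] square_integrable_lincomb[OF u(2) v(2)]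
    unfolding H1_mean_zero_def torus_L2_iff by blast
qed

lemma H1_mean_zero_0: "(\<lambda>x. 0) \<in> H1_mean_zero L"
  by (auto simp: H1_mean_zero_def torus_L2_iff torus_periodic_def has_weak_partial_def
      intro!: continuous_square_integrable_torus exI[of _ "\<lambda>x. 0"])

definition grad_norm :: "real \<Rightarrow> (real^3 \<Rightarrow> real) \<Rightarrow> real" where
  "grad_norm L u = L2_norm (torus L) (\<lambda>x. norm (weak_grad L u x))"

lemma norm_weak_grad_power2: "(norm (weak_grad L u x))\<^sup>2 = (\<Sum>i\<in>UNIV. (weak_partial L i u x)\<^sup>2)"
  unfolding power2_norm_eq_inner inner_vec_def weak_grad_def by (simp add: power2_eq_square)

lemma integrable_norm_weak_grad_power2:
  "u \<in> H1_mean_zero L \<Longrightarrow> integrable (torus L) (\<lambda>x. (norm (weak_grad L u x))\<^sup>2)"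
  unfolding norm_weak_grad_power2
  by (intro Bochner_Integration.integrable_sum square_integrableD weak_partial_square_integrable)

lemma grad_norm_nonneg [simp]: "grad_norm L u \<ge> 0"
  by (simp add: grad_norm_def)

lemma grad_norm_power2:
  assumes "u \<in> H1_mean_zero L"
  shows "(grad_norm L u)\<^sup>2 = (\<Sum>i\<in>UNIV. (L2_norm (torus L) (weak_partial L i u))\<^sup>2)"
  unfolding grad_norm_def L2_norm_power2 norm_weak_grad_power2
  by (intro Bochner_Integration.integral_sum square_integrableD weak_partial_square_integrable assms)

lemma weak_partial_le_grad_norm:
  assumes "u \<in> H1_mean_zero L"
  shows "L2_norm (torus L) (weak_partial L i u) \<le> grad_norm L u"
proof (rule power2_le_imp_le)
  show "(L2_norm (torus L) (weak_partial L i u))\<^sup>2 \<le> (grad_norm L u)\<^sup>2"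
    unfolding grad_norm_power2[OF assms] by (rule member_le_sum) auto
qed simp

context
  fixes L :: real
  assumes L: "L > 0"
begin

text \<open>
  Take trigonometric polynomials \<open>f\<close> close to \<open>u\<close>: then \<open>\<integral> u f\<close> is close to \<open>|u|\<^sup>2\<close> and \<open>|f|\<close> to \<open>|u|\<close>.
  With \<open>C = 0\<close> this gives uniqueness of weak derivatives, and for suitable \<open>C\<close> it gives the Poincare
  inequality.
\<close>

lemma L2_norm_le_by_duality:
  assumes u: "u \<in> square_integrable (torus L)" and C: "C \<ge> 0"
    and bd: "\<And>K c. finite K \<Longrightarrow> (\<And>x. Im (trig_poly L K c x) = 0) \<Longrightarrow>
      (\<integral>x. u x * Re (trig_poly L K c x) \<partial>torus L) \<le> C * L2_norm (torus L) (\<lambda>x. Re (trig_poly L K c x))"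
  shows "L2_norm (torus L) u \<le> C"
proof -
  define n where "n = L2_norm (torus L) u"
  have n: "n \<ge> 0" by (simp add: n_def)
  have "n\<^sup>2 \<le> C * n + e" if e: "e > 0" for e
  proof -
    define d where "d = e / (n + C + 1)"
    \<comment> \<open>The two errors below add up to \<open>d n + C d\<close>.\<close>
    have d: "d > 0" "(n + C) * d \<le> e" using e n C by (auto simp: d_def field_simps)
    obtain K c where K: "finite K" "\<And>x. Im (trig_poly L K c x) = 0"
      "L2_norm (torus L) (\<lambda>x. u x - Re (trig_poly L K c x)) < d"
      using trig_poly_dense[OF L u d(1)] by blast
    define f where "f x = Re (trig_poly L K c x)" for x
    have f: "f \<in> square_integrable (torus L)"
      unfolding f_def by (rule trig_poly_square_integrable[OF L])
    note uf = square_integrable_diff[OF u f]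
    have dn: "L2_norm (torus L) (\<lambda>x. u x - f x) < d" using K(3) by (simp add: f_def)
    have "n\<^sup>2 = (\<integral>x. u x * u x \<partial>torus L)" by (simp add: n_def L2_norm_power2 flip: power2_eq_square)
    also have "\<dots> = (\<integral>x. (u x - f x) * u x \<partial>torus L) + (\<integral>x. f x * u x \<partial>torus L)"
      using integral_lincomb_mult[OF uf f u, of 1 1] by simp
    also have "(\<integral>x. (u x - f x) * u x \<partial>torus L) \<le> d * n"
    proof -
      have "(\<integral>x. (u x - f x) * u x \<partial>torus L) \<le> L2_norm (torus L) (\<lambda>x. u x - f x) * n"
        using Cauchy_Schwarz_integral[OF uf u] by (simp add: n_def)
      also have "\<dots> \<le> d * n" using dn n by (intro mult_right_mono) auto
      finally show ?thesis .
    qed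
    also have "(\<integral>x. f x * u x \<partial>torus L) \<le> C * (n + d)"
    proof -
      have "(\<integral>x. f x * u x \<partial>torus L) \<le> C * L2_norm (torus L) f"
        using bd[OF K(1,2)] by (simp add: f_def [abs_def] mult.commute)
      also have "L2_norm (torus L) f \<le> L2_norm (torus L) (\<lambda>x. f x - u x) + n"
        using L2_norm_triangle[OF square_integrable_diff[OF f u] u] by (simp add: n_def)
      hence "L2_norm (torus L) f \<le> n + d" using dn L2_norm_commute[of "torus L" u f] by linarith
      hence "C * L2_norm (torus L) f \<le> C * (n + d)" using C by (intro mult_left_mono)
      finally show ?thesis .
    qed
    finally have "n\<^sup>2 \<le> C * n + (n + C) * d" by (simp add: algebra_simps)
    thus ?thesis using d by linarith
  qed
  hence "n\<^sup>2 \<le> C * n" by (rule field_le_epsilon)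
  hence "n * n \<le> C * n" by (simp add: power2_eq_square)
  hence "n \<le> C" using n C by (cases "n = 0") (auto simp: mult_le_cancel_right)
  thus ?thesis by (simp add: n_def)
qed

lemma has_weak_partial_unique:
  assumes "has_weak_partial L i u g" "has_weak_partial L i u h"
  shows "AE x in torus L. g x = h x"
proof -
  note g = has_weak_partialD[OF assms(1)] and h = has_weak_partialD[OF assms(2)]
  have "L2_norm (torus L) (\<lambda>x. g x - h x) \<le> 0"
  proof (rule L2_norm_le_by_duality)
    fix K c
    let ?f = "\<lambda>x. Re (trig_poly L K c x)"
    note f = trig_poly_test[OF L, of K c]
    have "(\<integral>x. (g x - h x) * ?f x \<partial>torus L) = 0"
      using integral_lincomb_mult[OF g(1) h(1) torus_test_square_integrable(1)[OF f], of 1 "-1"]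
        g(3)[OF f] h(3)[OF f] by simp
    thus "(\<integral>x. (g x - h x) * ?f x \<partial>torus L) \<le> 0 * L2_norm (torus L) ?f" by simp
  qed (auto intro: square_integrable_diff g h)
  hence "L2_norm (torus L) (\<lambda>x. g x - h x) = 0" by (simp add: antisym)
  from L2_norm_eq_0_AE[OF square_integrable_diff[OF g(1) h(1)] this] show ?thesis by simp
qed

text \<open>
  By duality it suffices to pair \<open>u\<close> with a trigonometric polynomial, whose
  mean is invisible to \<open>u\<close> and whose other part is a divergence.
\<close>

lemma Poincare:
  assumes u: "u \<in> square_integrable (torus L)" and mean: "(\<integral>x. u x \<partial>torus L) = 0"
    and g: "\<And>i. has_weak_partial L i u (g i)"
  shows "L2_norm (torus L) u \<le> L / (2 * pi) * (\<Sum>i\<in>UNIV. L2_norm (torus L) (g i))"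
proof (rule L2_norm_le_by_duality[OF u])
  show "0 \<le> L / (2 * pi) * (\<Sum>i\<in>UNIV. L2_norm (torus L) (g i))"
    using L by (intro mult_nonneg_nonneg sum_nonneg) auto
next
  fix K c assume K: "finite K" and real: "\<And>x. Im (trig_poly L K c x) = 0"
  define f where "f x = Re (trig_poly L K c x)" for x
  define m where "m = (if 0 \<in> K then Re (c 0) else 0)"
  have norm_f: "sqrt (\<integral>x. (cmod (trig_poly L K c x))\<^sup>2 \<partial>torus L) = L2_norm (torus L) f"
    using real by (simp add: L2_norm_def f_def cmod_power2)
  obtain d where d: "\<And>x. (\<Sum>i\<in>UNIV. partial i (\<lambda>y. Re (trig_poly L K (d i) y)) x) = f x - m"
    and dn: "\<And>i. L2_norm (torus L) (\<lambda>x. Re (trig_poly L K (d i) x)) \<le> L / (2 * pi) * L2_norm (torus L) f"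
    using trig_poly_divergence[OF L K, of c] unfolding norm_f f_def [symmetric] m_def [symmetric]
    by auto
  define \<phi> where "\<phi> i x = Re (trig_poly L K (d i) x)" for i x
  have \<phi>: "\<phi> i \<in> torus_test L" for i unfolding \<phi>_def by (rule trig_poly_test[OF L])
  note \<phi>L2 = torus_test_square_integrable[OF \<phi>]
  have f: "f \<in> square_integrable (torus L)"
    unfolding f_def by (rule trig_poly_square_integrable[OF L])
  have one: "(\<lambda>x. 1) \<in> square_integrable (torus L)"
    by (intro continuous_square_integrable_torus continuous_intros)
  have fm: "f x - m = (\<Sum>i\<in>UNIV. partial i (\<phi> i) x)" for x
    using d[of x] by (simp add: \<phi>_def [abs_def])
  have "(\<integral>x. u x * f x \<partial>torus L) = (\<integral>x. (f x - m) * u x \<partial>torus L)"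
    using integral_lincomb_mult[OF f one u, of 1 "-m"] mean by (simp add: mult.commute)
  also have "\<dots> = (\<integral>x. (\<Sum>i\<in>UNIV. u x * partial i (\<phi> i) x) \<partial>torus L)"
    unfolding fm by (simp add: sum_distrib_left sum_distrib_right mult.commute)
  also have "\<dots> = (\<Sum>i\<in>UNIV. \<integral>x. u x * partial i (\<phi> i) x \<partial>torus L)"
    by (intro Bochner_Integration.integral_sum integrable_mult_square_integrable u \<phi>L2)
  also have "\<dots> = (\<Sum>i\<in>UNIV. - (\<integral>x. g i x * \<phi> i x \<partial>torus L))"
    by (intro sum.cong refl has_weak_partialD(3)[OF g \<phi>])
  also have "\<dots> \<le> (\<Sum>i\<in>UNIV. L / (2 * pi) * L2_norm (torus L) (g i) * L2_norm (torus L) f)"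
  proof (rule sum_mono)
    fix i
    have "- (\<integral>x. g i x * \<phi> i x \<partial>torus L) \<le> L2_norm (torus L) (g i) * L2_norm (torus L) (\<phi> i)"
      using Cauchy_Schwarz_integral[OF has_weak_partialD(1)[OF g] \<phi>L2(1), of i i] by simp
    also have "\<dots> \<le> L2_norm (torus L) (g i) * (L / (2 * pi) * L2_norm (torus L) f)"
      using dn[of i] by (intro mult_left_mono) (simp_all add: \<phi>_def [abs_def])
    finally show "- (\<integral>x. g i x * \<phi> i x \<partial>torus L)
        \<le> L / (2 * pi) * L2_norm (torus L) (g i) * L2_norm (torus L) f" by (simp add: mult_ac)
  qed
  also have "\<dots> = L / (2 * pi) * (\<Sum>i\<in>UNIV. L2_norm (torus L) (g i)) * L2_norm (torus L) f"
    by (simp add: sum_distrib_left sum_distrib_right)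
  finally show "(\<integral>x. u x * Re (trig_poly L K c x) \<partial>torus L)
     \<le> L / (2 * pi) * (\<Sum>i\<in>UNIV. L2_norm (torus L) (g i)) * L2_norm (torus L) (\<lambda>x. Re (trig_poly L K c x))"
    by (simp add: f_def [abs_def])
qed

section \<open>The mean-zero Sobolev space\<close>

lemma weak_partial_AE_eq:
  assumes "u \<in> H1_mean_zero L" "has_weak_partial L i u g"
  shows "AE x in torus L. weak_partial L i u x = g x"
  by (rule has_weak_partial_unique[OF H1_mean_zeroD(4)[OF assms(1)] assms(2)])

lemma weak_grad_lincomb_AE:
  assumes "u \<in> H1_mean_zero L" "v \<in> H1_mean_zero L"
  shows "AE x in torus L. weak_grad L (\<lambda>x. a * u x + b * v x) x
           = a *\<^sub>R weak_grad L u x + b *\<^sub>R weak_grad L v x"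
proof -
  note u = H1_mean_zeroD[OF assms(1)] and v = H1_mean_zeroD[OF assms(2)]
  have "AE x in torus L. \<forall>i. weak_partial L i (\<lambda>x. a * u x + b * v x) x
      = a * weak_partial L i u x + b * weak_partial L i v x"
    unfolding AE_all_countable
    by (intro allI weak_partial_AE_eq H1_mean_zero_lincomb has_weak_partial_lincomb assms u v)
  thus ?thesis by eventually_elim (simp add: weak_grad_def vec_eq_iff)
qed

lemma norm_weak_grad_measurable:
  assumes "u \<in> H1_mean_zero L"
  shows "(\<lambda>x. norm (weak_grad L u x)) \<in> borel_measurable (torus L)"
proof -
  note [measurable] = square_integrableD(1)[OF weak_partial_square_integrable[OF assms]]
  have "(\<lambda>x. sqrt (\<Sum>i\<in>UNIV. (weak_partial L i u x)\<^sup>2)) \<in> borel_measurable (torus L)" by measurable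
  thus ?thesis by (simp flip: norm_weak_grad_power2)
qed

lemma grad_norm_cmult:
  assumes "u \<in> H1_mean_zero L"
  shows "grad_norm L (\<lambda>x. a * u x) = \<bar>a\<bar> * grad_norm L u"
proof -
  have "(\<lambda>x. a * u x) \<in> H1_mean_zero L" using H1_mean_zero_lincomb[OF assms assms, of a 0] by simp
  note m = norm_weak_grad_measurable[OF this] norm_weak_grad_measurable[OF assms]
  have "AE x in torus L. norm (weak_grad L (\<lambda>x. a * u x) x) = a * 0 + \<bar>a\<bar> * norm (weak_grad L u x)"
    using weak_grad_lincomb_AE[OF assms assms, of a 0] by eventually_elim simp
  hence "grad_norm L (\<lambda>x. a * u x) = L2_norm (torus L) (\<lambda>x. \<bar>a\<bar> * norm (weak_grad L u x))"
    unfolding grad_norm_def by (intro L2_norm_cong_AE m borel_measurable_times) (auto intro: m)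
  thus ?thesis by (simp add: L2_norm_cmult grad_norm_def)
qed

lemma L2_norm_le_grad_norm:
  assumes "u \<in> H1_mean_zero L"
  shows "L2_norm (torus L) u \<le> 3 * L / (2 * pi) * grad_norm L u"
proof -
  note u = H1_mean_zeroD[OF assms]
  have "(\<Sum>i\<in>UNIV. L2_norm (torus L) (weak_partial L i u)) \<le> (\<Sum>i\<in>(UNIV :: 3 set). grad_norm L u)"
    by (intro sum_mono weak_partial_le_grad_norm assms)
  hence "L / (2 * pi) * (\<Sum>i\<in>UNIV. L2_norm (torus L) (weak_partial L i u))
      \<le> L / (2 * pi) * (3 * grad_norm L u)"
    using L by (intro mult_left_mono) auto
  thus ?thesis using Poincare[OF u(2,3) u(4)] by simp
qed

lemma AE_eq_0_iff_grad_norm: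
  assumes "u \<in> H1_mean_zero L"
  shows "(AE x in torus L. u x = 0) \<longleftrightarrow> grad_norm L u = 0"
proof
  assume "grad_norm L u = 0"
  hence "L2_norm (torus L) u = 0"
    using L2_norm_le_grad_norm[OF assms] by (simp add: antisym)
  thus "AE x in torus L. u x = 0" by (rule L2_norm_eq_0_AE[OF H1_mean_zeroD(2)[OF assms]])
next
  assume ae: "AE x in torus L. u x = 0"
  have "L2_norm (torus L) (weak_partial L i u) = 0" for i
  proof -
    have "has_weak_partial L i u (\<lambda>x. 0)"
      unfolding has_weak_partial_def torus_L2_iff
    proof (intro conjI ballI)
      fix f assume "f \<in> torus_test L"
      have "(\<integral>x. u x * partial i f x \<partial>torus L) = 0"
        by (rule integral_eq_zero_AE) (use ae in eventually_elim, simp)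
      thus "(\<integral>x. u x * partial i f x \<partial>torus L) = - (\<integral>x. 0 * f x \<partial>torus L)" by simp
    qed (auto simp: torus_periodic_def intro!: continuous_square_integrable_torus)
    from weak_partial_AE_eq[OF assms this]
    have "L2_norm (torus L) (weak_partial L i u) = L2_norm (torus L) (\<lambda>x. 0)"
      by (rule L2_norm_cong_AE[OF _ square_integrableD(1)[OF weak_partial_square_integrable[OF assms]]])
         simp
    thus ?thesis by (simp add: L2_norm_def)
  qed
  hence "(grad_norm L u)\<^sup>2 = 0" by (simp add: grad_norm_power2[OF assms])
  thus "grad_norm L u = 0" by simp
qed

lemma H1_norm_le_grad_norm:
  assumes "u \<in> H1_mean_zero L"
  shows "H1_norm L u \<le> (3 * L / (2 * pi) + 1) * grad_norm L u"
proof -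
  let ?k = "3 * L / (2 * pi)"
  have k: "?k \<ge> 0" using L by simp
  have "H1_norm L u = sqrt ((L2_norm (torus L) u)\<^sup>2 + (grad_norm L u)\<^sup>2)"
    unfolding H1_norm_def grad_norm_def L2_norm_power2
    using Bochner_Integration.integral_add[OF square_integrableD(2)[OF H1_mean_zeroD(2)[OF assms]]
        integrable_norm_weak_grad_power2[OF assms]] by simp
  also have "\<dots> \<le> L2_norm (torus L) u + grad_norm L u"
    by (rule sqrt_sum_squares_le_sum) auto
  also have "\<dots> \<le> (?k + 1) * grad_norm L u"
    using L2_norm_le_grad_norm[OF assms] by (simp add: algebra_simps)
  finally show ?thesis .
qed

text \<open>
  By the Poincare inequality both the functions and their weak derivatives are Cauchy in \<open>L\<^sup>2\<close>.  Their
  limits are related as function and weak derivative because every test integral is continuous in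
  \<open>L\<^sup>2\<close>; the same holds for the mean.
\<close>

lemma H1_complete:
  assumes p: "\<And>n. p n \<in> H1_mean_zero L"
    and Cauchy: "\<And>e. e > 0 \<Longrightarrow> \<exists>N. \<forall>m\<ge>N. \<forall>n\<ge>N. grad_norm L (\<lambda>x. p m x - p n x) < e"
  shows "\<exists>u\<in>H1_mean_zero L. (\<lambda>n. grad_norm L (\<lambda>x. p n x - u x)) \<longlonglongrightarrow> 0"
proof -
  have diff: "(\<lambda>x. f x - g x) \<in> H1_mean_zero L" if "f \<in> H1_mean_zero L" "g \<in> H1_mean_zero L" for f g
    using H1_mean_zero_lincomb[OF that, of 1 "-1"] by simp
  have wdiff: "L2_norm (torus L) (weak_partial L i (\<lambda>x. f x - g x))
      = L2_norm (torus L) (\<lambda>x. weak_partial L i f x - h x)"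
    if fg: "f \<in> H1_mean_zero L" "g \<in> H1_mean_zero L" and h: "has_weak_partial L i g h" for f g h i
  proof (rule L2_norm_cong_AE)
    note f' = H1_mean_zeroD[OF fg(1)] and g' = H1_mean_zeroD[OF fg(2)]
    have "has_weak_partial L i (\<lambda>x. f x - g x) (\<lambda>x. weak_partial L i f x - h x)"
      using has_weak_partial_lincomb[OF f'(2) g'(2) f'(4) h, of 1 "-1"] by simp
    thus "AE x in torus L. weak_partial L i (\<lambda>x. f x - g x) x = weak_partial L i f x - h x"
      by (rule weak_partial_AE_eq[OF diff[OF fg]])
    show "weak_partial L i (\<lambda>x. f x - g x) \<in> borel_measurable (torus L)"
      by (intro square_integrableD weak_partial_square_integrable diff fg)
    show "(\<lambda>x. weak_partial L i f x - h x) \<in> borel_measurable (torus L)"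
      by (intro square_integrableD square_integrable_diff weak_partial_square_integrable fg
          has_weak_partialD(1)[OF h])
  qed
  have "\<exists>u\<in>torus_L2 L. (\<lambda>n. L2_norm (torus L) (\<lambda>x. p n x - u x)) \<longlonglongrightarrow> 0"
  proof (rule torus_L2_complete)
    show "p n \<in> torus_L2 L" for n using p[of n] by (simp add: H1_mean_zero_def)
    fix e :: real assume e: "e > 0"
    let ?k = "3 * L / (2 * pi)"
    have k: "?k > 0" using L by simp
    obtain N where N: "\<forall>m\<ge>N. \<forall>n\<ge>N. grad_norm L (\<lambda>x. p m x - p n x) < e / ?k"
      using Cauchy[OF divide_pos_pos[OF e k]] by blast
    have "L2_norm (torus L) (\<lambda>x. p m x - p n x) < e" if "m \<ge> N" "n \<ge> N" for m n
    proof -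
      have "L2_norm (torus L) (\<lambda>x. p m x - p n x) \<le> ?k * grad_norm L (\<lambda>x. p m x - p n x)"
        by (intro L2_norm_le_grad_norm diff p)
      also have "\<dots> < ?k * (e / ?k)" using N that k by (intro mult_strict_left_mono) auto
      also have "\<dots> = e" using k L by simp
      finally show ?thesis .
    qed
    thus "\<exists>N. \<forall>m\<ge>N. \<forall>n\<ge>N. L2_norm (torus L) (\<lambda>x. p m x - p n x) < e" by blast
  qed
  then obtain u where u: "u \<in> torus_L2 L" "(\<lambda>n. L2_norm (torus L) (\<lambda>x. p n x - u x)) \<longlonglongrightarrow> 0"
    by blast
  have "\<forall>i. \<exists>g. g \<in> torus_L2 L \<and> (\<lambda>n. L2_norm (torus L) (\<lambda>x. weak_partial L i (p n) x - g x)) \<longlonglongrightarrow> 0"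
  proof
    fix i
    have "\<exists>g\<in>torus_L2 L. (\<lambda>n. L2_norm (torus L) (\<lambda>x. weak_partial L i (p n) x - g x)) \<longlonglongrightarrow> 0"
    proof (rule torus_L2_complete)
      show "weak_partial L i (p n) \<in> torus_L2 L" for n
        using H1_mean_zeroD(4)[OF p] by (simp add: has_weak_partial_def)
      fix e :: real assume e: "e > 0"
      obtain N where N: "\<forall>m\<ge>N. \<forall>n\<ge>N. grad_norm L (\<lambda>x. p m x - p n x) < e"
        using Cauchy[OF e] by blast
      have "L2_norm (torus L) (\<lambda>x. weak_partial L i (p m) x - weak_partial L i (p n) x) < e"
        if "m \<ge> N" "n \<ge> N" for m n
        using weak_partial_le_grad_norm[OF diff[OF p p], of i m n] N that
          wdiff[OF p p H1_mean_zeroD(4)[OF p], of i m n] by force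
      thus "\<exists>N. \<forall>m\<ge>N. \<forall>n\<ge>N.
         L2_norm (torus L) (\<lambda>x. weak_partial L i (p m) x - weak_partial L i (p n) x) < e" by blast
    qed
    thus "\<exists>g. g \<in> torus_L2 L \<and> (\<lambda>n. L2_norm (torus L) (\<lambda>x. weak_partial L i (p n) x - g x)) \<longlonglongrightarrow> 0"
      by blast
  qed
  from choice[OF this] obtain g where g: "\<And>i. g i \<in> torus_L2 L"
    "\<And>i. (\<lambda>n. L2_norm (torus L) (\<lambda>x. weak_partial L i (p n) x - g i x)) \<longlonglongrightarrow> 0" by blast
  have uL2: "u \<in> square_integrable (torus L)" and gL2: "g i \<in> square_integrable (torus L)" for i
    using u(1) g(1) by (auto simp: torus_L2_iff)
  have wk: "has_weak_partial L i u (g i)" for i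
    unfolding has_weak_partial_def
  proof (intro conjI ballI g)
    fix f assume f: "f \<in> torus_test L"
    note ff = torus_test_square_integrable[OF f]
    have "(\<lambda>n. \<integral>x. p n x * partial i f x \<partial>torus L) \<longlonglongrightarrow> (\<integral>x. u x * partial i f x \<partial>torus L)"
      by (intro tendsto_integral_mult H1_mean_zeroD(2)[OF p] uL2 ff u)
    moreover have "(\<lambda>n. - (\<integral>x. weak_partial L i (p n) x * f x \<partial>torus L))
        \<longlonglongrightarrow> - (\<integral>x. g i x * f x \<partial>torus L)"
      by (intro tendsto_minus tendsto_integral_mult weak_partial_square_integrable p gL2 ff g)
    ultimately show "(\<integral>x. u x * partial i f x \<partial>torus L) = - (\<integral>x. g i x * f x \<partial>torus L)"
      using has_weak_partialD(3)[OF H1_mean_zeroD(4)[OF p] f] by (simp add: LIMSEQ_unique)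
  qed
  have one: "(\<lambda>x. 1) \<in> square_integrable (torus L)"
    by (intro continuous_square_integrable_torus continuous_intros)
  have "(\<lambda>n. \<integral>x. p n x * 1 \<partial>torus L) \<longlonglongrightarrow> (\<integral>x. u x * 1 \<partial>torus L)"
    by (intro tendsto_integral_mult H1_mean_zeroD(2)[OF p] uL2 one u)
  hence mean: "(\<integral>x. u x \<partial>torus L) = 0"
    using H1_mean_zeroD(3)[OF p] by (simp add: LIMSEQ_const_iff)
  have uH: "u \<in> H1_mean_zero L"
    unfolding H1_mean_zero_def using u(1) wk mean by blast
  have "(\<lambda>n. sqrt (\<Sum>i\<in>UNIV. (L2_norm (torus L) (\<lambda>x. weak_partial L i (p n) x - g i x))\<^sup>2))
      \<longlonglongrightarrow> sqrt (\<Sum>i\<in>(UNIV::3 set). 0\<^sup>2)"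
    by (intro tendsto_intros g)
  moreover have "grad_norm L (\<lambda>x. p n x - u x)
      = sqrt (\<Sum>i\<in>UNIV. (L2_norm (torus L) (\<lambda>x. weak_partial L i (p n) x - g i x))\<^sup>2)" for n
  proof -
    have "(grad_norm L (\<lambda>x. p n x - u x))\<^sup>2
        = (\<Sum>i\<in>UNIV. (L2_norm (torus L) (\<lambda>x. weak_partial L i (p n) x - g i x))\<^sup>2)"
      unfolding grad_norm_power2[OF diff[OF p uH]] wdiff[OF p uH wk] ..
    thus ?thesis by (metis grad_norm_nonneg real_sqrt_unique)
  qed
  ultimately have "(\<lambda>n. grad_norm L (\<lambda>x. p n x - u x)) \<longlonglongrightarrow> 0" by simp
  thus ?thesis using uH by blast
qed

end

section \<open>The energy and its first variation\<close>

lemma neg_part_square_expansion: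
  fixes r h :: real
  shows "- (1/4) * h\<^sup>2 \<le> - (1/4) * (min (r - h) 0)\<^sup>2 + 1/4 * (min r 0)\<^sup>2 - 1/2 * min r 0 * h"
    and "- (1/4) * (min (r - h) 0)\<^sup>2 + 1/4 * (min r 0)\<^sup>2 - 1/2 * min r 0 * h \<le> 0"
proof -
  consider "r \<le> 0" "r - h \<le> 0" | "r \<le> 0" "r - h > 0" | "r > 0" "r - h \<le> 0" | "r > 0" "r - h > 0"
    by linarith
  hence "- (1/4) * h\<^sup>2 \<le> - (1/4) * (min (r - h) 0)\<^sup>2 + 1/4 * (min r 0)\<^sup>2 - 1/2 * min r 0 * h \<and>
    - (1/4) * (min (r - h) 0)\<^sup>2 + 1/4 * (min r 0)\<^sup>2 - 1/2 * min r 0 * h \<le> 0"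
  proof cases
    case 1 thus ?thesis by (simp add: power2_eq_square algebra_simps)
  next
    case 2
    have "0 \<le> (r - h)\<^sup>2" by simp
    moreover have "r * (r - 2 * h) \<le> 0" using 2 by (intro mult_nonpos_nonneg) auto
    ultimately show ?thesis using 2 by (simp add: power2_eq_square algebra_simps)
  next
    case 3
    have "(r - h)\<^sup>2 \<le> h\<^sup>2" using 3 by (intro abs_le_square_iff [THEN iffD1]) auto
    thus ?thesis using 3 by simp
  qed simp
  thus "- (1/4) * h\<^sup>2 \<le> - (1/4) * (min (r - h) 0)\<^sup>2 + 1/4 * (min r 0)\<^sup>2 - 1/2 * min r 0 * h"
    and "- (1/4) * (min (r - h) 0)\<^sup>2 + 1/4 * (min r 0)\<^sup>2 - 1/2 * min r 0 * h \<le> 0" by auto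
qed

definition energy_density :: "real \<Rightarrow> real^3 \<Rightarrow> real" where
  "energy_density m v = 1/2 * (norm v)\<^sup>2 - 1/4 * (min (m - v $ 3) 0)\<^sup>2"

text \<open>
  The concave term has second derivative at least \<open>- 1/2\<close> in a single direction, so the density is
  squeezed between paraboloids of curvatures \<open>1/2\<close> and \<open>1\<close> that touch it at any given point.
\<close>

lemma energy_density_expansion:
  fixes v w :: "real^3" and m t :: real
  defines "a \<equiv> v \<bullet> w + 1/2 * min (m - v $ 3) 0 * w $ 3"
  shows "energy_density m v + t * a + 1/4 * t\<^sup>2 * (norm w)\<^sup>2 \<le> energy_density m (v + t *\<^sub>R w)"
    and "energy_density m (v + t *\<^sub>R w) \<le> energy_density m v + t * a + 1/2 * t\<^sup>2 * (norm w)\<^sup>2"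
proof -
  have nrm: "(norm (v + t *\<^sub>R w))\<^sup>2 = (norm v)\<^sup>2 + 2 * t * (v \<bullet> w) + t\<^sup>2 * (norm w)\<^sup>2"
    unfolding power2_norm_eq_inner
    by (simp add: inner_add_left inner_add_right inner_commute power2_eq_square algebra_simps)
  have "(w $ 3)\<^sup>2 \<le> (norm w)\<^sup>2"
    using component_le_norm_cart[of w 3] by (simp add: abs_le_square_iff [symmetric])
  hence w3: "t\<^sup>2 * (w $ 3)\<^sup>2 \<le> t\<^sup>2 * (norm w)\<^sup>2" by (intro mult_left_mono) auto
  have e: "m - (v + t *\<^sub>R w) $ 3 = (m - v $ 3) - t * w $ 3" by simp
  have ta: "t * a = t * (v \<bullet> w) + 1/2 * min (m - v $ 3) 0 * (t * w $ 3)"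
    by (simp add: a_def algebra_simps)
  note n = neg_part_square_expansion[where r = "m - v $ 3" and h = "t * w $ 3"]
  show "energy_density m v + t * a + 1/4 * t\<^sup>2 * (norm w)\<^sup>2 \<le> energy_density m (v + t *\<^sub>R w)"
    unfolding energy_density_def nrm e ta
    using n(1) w3 by (simp only: power_mult_distrib distrib_left)
  show "energy_density m (v + t *\<^sub>R w) \<le> energy_density m v + t * a + 1/2 * t\<^sup>2 * (norm w)\<^sup>2"
    unfolding energy_density_def nrm e ta
    using n(2) by (simp only: distrib_left)
qed

text \<open>
  This turns minimality along a line, together with the upper bound of the expansion, into
  vanishing of the first variation.
\<close>

lemma linear_coefficient_eq_0:
  fixes G N :: real
  assumes "\<And>t. 0 \<le> t * G + 1/2 * t\<^sup>2 * N" and "N \<ge> 0"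
  shows "G = 0"
proof -
  \<comment> \<open>Replacing \<open>N\<close> by \<open>N + 1\<close> weakens the hypothesis but makes the minimum point exist for \<open>N = 0\<close>.\<close>
  define t where "t = - G / (N + 1)"
  have t: "t * (N + 1) = - G" using assms(2) by (simp add: t_def)
  have "0 \<le> t * G + 1/2 * t\<^sup>2 * N" by (rule assms(1))
  also have "\<dots> \<le> t * G + 1/2 * t * (t * (N + 1))"
    by (simp add: power2_eq_square algebra_simps)
  also have "\<dots> = - (1/2 * (G\<^sup>2 / (N + 1)))"
  proof -
    have "t * G = - (G\<^sup>2 / (N + 1))" by (simp add: t_def power2_eq_square)
    moreover have "1/2 * t * (- G) = - (1/2 * (t * G))" by simp
    ultimately show ?thesis unfolding t by linarith
  qed
  finally have "G\<^sup>2 / (N + 1) \<le> 0" by linarith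
  hence "G\<^sup>2 \<le> 0" using assms(2) by (simp add: divide_le_0_iff)
  thus ?thesis by simp
qed

definition energy_variation ::
  "real \<Rightarrow> (real^3 \<Rightarrow> real) \<Rightarrow> ((real^3 \<Rightarrow> real) \<Rightarrow> real) \<Rightarrow> (real^3 \<Rightarrow> real) \<Rightarrow> (real^3 \<Rightarrow> real) \<Rightarrow> real"
  where
  "energy_variation L M F p f =
     (\<integral>x. weak_grad L p x \<bullet> weak_grad L f x
        + 1/2 * min (M x - weak_partial L 3 p x) 0 * weak_partial L 3 f x \<partial>torus L) + F f"

lemma weak_solution_iff:
  "weak_solution L M F p \<longleftrightarrow> (\<forall>f\<in>H1_mean_zero L. energy_variation L M F p f = 0)"
  unfolding weak_solution_def energy_variation_def by (auto simp: eq_neg_iff_add_eq_0)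

lemma energy_eq: "energy L M F p = (\<integral>x. energy_density (M x) (weak_grad L p x) \<partial>torus L) + F p"
  by (simp add: energy_def energy_density_def weak_grad_def)

lemma min_square_integrable:
  assumes "u \<in> square_integrable M"
  shows "(\<lambda>x. min (u x) 0) \<in> square_integrable M"
proof -
  note [measurable] = square_integrableD(1)[OF assms]
  have "integrable M (\<lambda>x. (min (u x) 0)\<^sup>2)"
    by (rule Bochner_Integration.integrable_bound[OF square_integrableD(2)[OF assms]])
       (auto simp: min_def)
  thus ?thesis by (auto simp: square_integrable_def)
qed

context
  fixes L :: real and M :: "real^3 \<Rightarrow> real" and F :: "(real^3 \<Rightarrow> real) \<Rightarrow> real"
  assumes L: "L > 0" and M: "M \<in> torus_L2 L" and F: "F \<in> H_minus1 L"
begin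

lemma M_square_integrable: "M \<in> square_integrable (torus L)"
  using M by (simp add: torus_L2_iff)

lemma F_lincomb:
  assumes "u \<in> H1_mean_zero L" "v \<in> H1_mean_zero L"
  shows "F (\<lambda>x. u x + t * v x) = F u + t * F v"
proof -
  have "(\<lambda>x. t * v x) \<in> H1_mean_zero L" using H1_mean_zero_lincomb[OF assms(2,2), of t 0] by simp
  thus ?thesis using F assms unfolding H_minus1_def by simp
qed

lemma F_bounded: "\<exists>C\<ge>0. \<forall>u\<in>H1_mean_zero L. \<bar>F u\<bar> \<le> C * grad_norm L u"
proof -
  obtain C where C: "\<And>u. u \<in> H1_mean_zero L \<Longrightarrow> \<bar>F u\<bar> \<le> C * H1_norm L u"
    using F unfolding H_minus1_def by blast
  have "\<bar>F u\<bar> \<le> \<bar>C\<bar> * (3 * L / (2 * pi) + 1) * grad_norm L u" if u: "u \<in> H1_mean_zero L" for u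
  proof -
    have "0 \<le> H1_norm L u" by (simp add: H1_norm_def)
    hence "C * H1_norm L u \<le> \<bar>C\<bar> * H1_norm L u" by (intro mult_right_mono) auto
    also have "\<dots> \<le> \<bar>C\<bar> * ((3 * L / (2 * pi) + 1) * grad_norm L u)"
      by (intro mult_left_mono H1_norm_le_grad_norm L u) auto
    finally show ?thesis using C[OF u] by (simp add: mult_ac)
  qed
  thus ?thesis using L by (intro exI[of _ "\<bar>C\<bar> * (3 * L / (2 * pi) + 1)"]) auto
qed

lemma min_term_square_integrable:
  assumes "p \<in> H1_mean_zero L"
  shows "(\<lambda>x. min (M x - weak_partial L 3 p x) 0) \<in> square_integrable (torus L)"
  by (intro min_square_integrable square_integrable_diff M_square_integrable
      weak_partial_square_integrable assms)

lemma integrable_energy_density: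
  assumes "p \<in> H1_mean_zero L"
  shows "integrable (torus L) (\<lambda>x. energy_density (M x) (weak_grad L p x))"
  using square_integrableD(2)[OF min_term_square_integrable[OF assms]]
    integrable_norm_weak_grad_power2[OF assms]
  by (simp add: energy_density_def weak_grad_def)

lemma integrable_inner_weak_grad:
  assumes "p \<in> H1_mean_zero L" "f \<in> H1_mean_zero L"
  shows "integrable (torus L) (\<lambda>x. weak_grad L p x \<bullet> weak_grad L f x)"
  unfolding inner_vec_def weak_grad_def vec_lambda_beta inner_real_def
  by (intro Bochner_Integration.integrable_sum integrable_mult_square_integrable
      weak_partial_square_integrable assms)

lemma integrable_min_term:
  assumes "p \<in> H1_mean_zero L" "f \<in> H1_mean_zero L"
  shows "integrable (torus L) (\<lambda>x. 1/2 * min (M x - weak_partial L 3 p x) 0 * weak_partial L 3 f x)"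
  unfolding mult.assoc
  by (intro integrable_mult_right integrable_mult_square_integrable min_term_square_integrable
      weak_partial_square_integrable assms)

text \<open>
  The pointwise expansion integrates, since the weak gradient is linear up to null sets.
\<close>

lemma energy_expansion:
  assumes p: "p \<in> H1_mean_zero L" and f: "f \<in> H1_mean_zero L"
  shows "energy L M F p + t * energy_variation L M F p f + 1/4 * t\<^sup>2 * (grad_norm L f)\<^sup>2
           \<le> energy L M F (\<lambda>x. p x + t * f x)" (is ?lower)
    and "energy L M F (\<lambda>x. p x + t * f x)
           \<le> energy L M F p + t * energy_variation L M F p f + 1/2 * t\<^sup>2 * (grad_norm L f)\<^sup>2" (is ?upper)
proof -
  let ?e = "\<lambda>p x. energy_density (M x) (weak_grad L p x)"
  define q where "q x = p x + t * f x" for x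
  define a where "a x = weak_grad L p x \<bullet> weak_grad L f x
        + 1/2 * min (M x - weak_partial L 3 p x) 0 * weak_partial L 3 f x" for x
  define n where "n x = (norm (weak_grad L f x))\<^sup>2" for x
  have q: "q \<in> H1_mean_zero L" using H1_mean_zero_lincomb[OF p f, of 1 t] by (simp add: q_def [abs_def])
  have int: "integrable (torus L) (?e p)" "integrable (torus L) (?e q)"
    "integrable (torus L) a" "integrable (torus L) n"
    unfolding a_def n_def
    by (intro integrable_energy_density Bochner_Integration.integrable_add
        integrable_inner_weak_grad integrable_min_term integrable_norm_weak_grad_power2 p q f)+
  have rhs: "(\<integral>x. ?e p x + t * a x + c * n x \<partial>torus L)
      = (\<integral>x. ?e p x \<partial>torus L) + t * (\<integral>x. a x \<partial>torus L) + c * (grad_norm L f)\<^sup>2"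
    and rint: "integrable (torus L) (\<lambda>x. ?e p x + t * a x + c * n x)" for c
    using int by (simp_all add: grad_norm_def L2_norm_power2 n_def [abs_def])
  have ae: "AE x in torus L. weak_grad L q x = weak_grad L p x + t *\<^sub>R weak_grad L f x"
    using weak_grad_lincomb_AE[OF L p f, of 1 t] by (simp add: q_def [abs_def])
  have "(\<integral>x. ?e p x + t * a x + 1/4 * t\<^sup>2 * n x \<partial>torus L) \<le> (\<integral>x. ?e q x \<partial>torus L)"
  proof (rule integral_mono_AE[OF rint int(2)])
    show "AE x in torus L. ?e p x + t * a x + 1/4 * t\<^sup>2 * n x \<le> ?e q x"
      using ae
    proof eventually_elim
      case (elim x)
      thus ?case
        using energy_density_expansion(1)[of "M x" "weak_grad L p x" t "weak_grad L f x"]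
        by (simp add: a_def n_def weak_grad_def)
    qed
  qed
  thus ?lower
    unfolding rhs energy_eq F_lincomb[OF p f] q_def [symmetric]
    by (simp add: energy_variation_def a_def [abs_def] q_def [abs_def] F_lincomb[OF p f] algebra_simps)
  have "(\<integral>x. ?e q x \<partial>torus L) \<le> (\<integral>x. ?e p x + t * a x + 1/2 * t\<^sup>2 * n x \<partial>torus L)"
  proof (rule integral_mono_AE[OF int(2) rint])
    show "AE x in torus L. ?e q x \<le> ?e p x + t * a x + 1/2 * t\<^sup>2 * n x"
      using ae
    proof eventually_elim
      case (elim x)
      thus ?case
        using energy_density_expansion(2)[of "M x" "weak_grad L p x" t "weak_grad L f x"]
        by (simp add: a_def n_def weak_grad_def)
    qed
  qed
  thus ?upper
    unfolding rhs energy_eq F_lincomb[OF p f] q_def [symmetric]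
    by (simp add: energy_variation_def a_def [abs_def] q_def [abs_def] F_lincomb[OF p f] algebra_simps)
qed

text \<open>
  The constant may depend on \<open>p\<close>; boundedness of the linear functional in the gradient norm uses the
  Poincare inequality.
\<close>

lemma energy_variation_bounded:
  assumes p: "p \<in> H1_mean_zero L"
  shows "\<exists>C\<ge>0. \<forall>f\<in>H1_mean_zero L. \<bar>energy_variation L M F p f\<bar> \<le> C * grad_norm L f"
proof -
  obtain C where C: "C \<ge> 0" "\<And>f. f \<in> H1_mean_zero L \<Longrightarrow> \<bar>F f\<bar> \<le> C * grad_norm L f"
    using F_bounded by blast
  define b where "b x = min (M x - weak_partial L 3 p x) 0" for x
  have b: "b \<in> square_integrable (torus L)"
    using min_term_square_integrable[OF p] by (simp add: b_def [abs_def])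
  define D where "D = (\<Sum>i\<in>UNIV. L2_norm (torus L) (weak_partial L i p)) + 1/2 * L2_norm (torus L) b + C"
  have "\<bar>energy_variation L M F p f\<bar> \<le> D * grad_norm L f" if f: "f \<in> H1_mean_zero L" for f
  proof -
    have CS: "\<bar>\<integral>x. u x * weak_partial L i f x \<partial>torus L\<bar> \<le> L2_norm (torus L) u * grad_norm L f"
      if "u \<in> square_integrable (torus L)" for u i
    proof -
      have "\<bar>\<integral>x. u x * weak_partial L i f x \<partial>torus L\<bar>
          \<le> L2_norm (torus L) u * L2_norm (torus L) (weak_partial L i f)"
        by (intro Cauchy_Schwarz_integral that weak_partial_square_integrable f)
      also have "\<dots> \<le> L2_norm (torus L) u * grad_norm L f"
        by (intro mult_left_mono weak_partial_le_grad_norm f) simp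
      finally show ?thesis .
    qed
    have "energy_variation L M F p f
      = (\<integral>x. weak_grad L p x \<bullet> weak_grad L f x \<partial>torus L)
        + (\<integral>x. 1/2 * b x * weak_partial L 3 f x \<partial>torus L) + F f"
      unfolding energy_variation_def b_def
      by (simp only: Bochner_Integration.integral_add[OF integrable_inner_weak_grad[OF p f]
            integrable_min_term[OF p f]])
    also have "(\<integral>x. weak_grad L p x \<bullet> weak_grad L f x \<partial>torus L)
        = (\<Sum>i\<in>UNIV. \<integral>x. weak_partial L i p x * weak_partial L i f x \<partial>torus L)"
      unfolding inner_vec_def weak_grad_def vec_lambda_beta inner_real_def
      by (intro Bochner_Integration.integral_sum integrable_mult_square_integrable
          weak_partial_square_integrable p f)
    also have "(\<integral>x. 1/2 * b x * weak_partial L 3 f x \<partial>torus L)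
        = 1/2 * (\<integral>x. b x * weak_partial L 3 f x \<partial>torus L)"
      unfolding mult.assoc by (rule integral_mult_right_zero)
    finally have eq: "energy_variation L M F p f
      = (\<Sum>i\<in>UNIV. \<integral>x. weak_partial L i p x * weak_partial L i f x \<partial>torus L)
        + 1/2 * (\<integral>x. b x * weak_partial L 3 f x \<partial>torus L) + F f" .
    have "\<bar>\<Sum>i\<in>UNIV. \<integral>x. weak_partial L i p x * weak_partial L i f x \<partial>torus L\<bar>
        \<le> (\<Sum>i\<in>UNIV. L2_norm (torus L) (weak_partial L i p) * grad_norm L f)"
      by (intro order_trans[OF sum_abs] sum_mono CS weak_partial_square_integrable p)
    hence "\<bar>\<Sum>i\<in>UNIV. \<integral>x. weak_partial L i p x * weak_partial L i f x \<partial>torus L\<bar>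
        \<le> (\<Sum>i\<in>UNIV. L2_norm (torus L) (weak_partial L i p)) * grad_norm L f"
      by (simp add: sum_distrib_right)
    thus ?thesis unfolding eq D_def distrib_right using CS[OF b, of 3] C(2)[OF f] by linarith
  qed
  moreover have "D \<ge> 0" unfolding D_def using C(1) by (intro add_nonneg_nonneg sum_nonneg) auto
  ultimately show ?thesis by blast
qed

lemma H1_mean_zero_diff:
  "u \<in> H1_mean_zero L \<Longrightarrow> v \<in> H1_mean_zero L \<Longrightarrow> (\<lambda>x. u x - v x) \<in> H1_mean_zero L"
  using H1_mean_zero_lincomb[of u L v 1 "-1"] by simp

text \<open>
  In the expansion at \<open>0\<close> the quadratic term dominates the linear one.
\<close>

lemma energy_bounded_below: "\<exists>c. \<forall>p\<in>H1_mean_zero L. c \<le> energy L M F p"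
proof -
  obtain C where C: "\<And>f. f \<in> H1_mean_zero L \<Longrightarrow>
      \<bar>energy_variation L M F (\<lambda>x. 0) f\<bar> \<le> C * grad_norm L f"
    using energy_variation_bounded[OF H1_mean_zero_0] by blast
  have "energy L M F (\<lambda>x. 0) - C\<^sup>2 \<le> energy L M F p" if p: "p \<in> H1_mean_zero L" for p
  proof -
    \<comment> \<open>completing the square in the gradient norm\<close>
    have "0 \<le> (1/2 * grad_norm L p - C)\<^sup>2" by simp
    hence "- C\<^sup>2 \<le> - (C * grad_norm L p) + 1/4 * (grad_norm L p)\<^sup>2"
      by (simp add: power2_eq_square algebra_simps)
    thus ?thesis using energy_expansion(1)[OF H1_mean_zero_0 p, of 1] C[OF p] by simp
  qed
  thus ?thesis by blast
qed

text \<open>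
  The lower expansions at the midpoint in the two opposite directions are added, so that the first
  variation cancels.
\<close>

lemma energy_midpoint:
  assumes p: "p \<in> H1_mean_zero L" and q: "q \<in> H1_mean_zero L"
  shows "2 * energy L M F (\<lambda>x. (p x + q x) / 2) + 1/8 * (grad_norm L (\<lambda>x. p x - q x))\<^sup>2
           \<le> energy L M F p + energy L M F q"
proof -
  define c where "c x = (p x + q x) / 2" for x
  define d where "d x = 1/2 * (p x - q x)" for x
  have c: "c \<in> H1_mean_zero L"
    using H1_mean_zero_lincomb[OF p q, of "1/2" "1/2"] by (simp add: c_def [abs_def] add_divide_distrib)
  have d: "d \<in> H1_mean_zero L"
    using H1_mean_zero_lincomb[OF p q, of "1/2" "-1/2"] by (simp add: d_def [abs_def] diff_divide_distrib)
  have "grad_norm L d = 1/2 * grad_norm L (\<lambda>x. p x - q x)"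
    unfolding d_def [abs_def] by (subst grad_norm_cmult[OF L H1_mean_zero_diff[OF p q]]) simp
  hence "(grad_norm L d)\<^sup>2 = 1/4 * (grad_norm L (\<lambda>x. p x - q x))\<^sup>2"
    by (simp only: power_mult_distrib) (simp add: power2_eq_square)
  moreover have "(\<lambda>x. c x + 1 * d x) = p" "(\<lambda>x. c x + (-1) * d x) = q"
    by (auto simp: c_def d_def fun_eq_iff field_simps)
  hence "energy L M F c + energy_variation L M F c d + 1/4 * (grad_norm L d)\<^sup>2 \<le> energy L M F p"
    "energy L M F c - energy_variation L M F c d + 1/4 * (grad_norm L d)\<^sup>2 \<le> energy L M F q"
    using energy_expansion(1)[OF c d, of 1] energy_expansion(1)[OF c d, of "-1"] by simp_all
  ultimately show ?thesis unfolding c_def [symmetric] by linarith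
qed

text \<open>
  Lower semicontinuity, again from the lower expansion, now at the limit: the linear term tends to
  zero and the quadratic one has the right sign.
\<close>

lemma energy_le_limit:
  assumes u: "u \<in> H1_mean_zero L" and p: "\<And>n. p n \<in> H1_mean_zero L"
    and lim: "(\<lambda>n. grad_norm L (\<lambda>x. p n x - u x)) \<longlonglongrightarrow> 0"
    and e: "(\<lambda>n. energy L M F (p n)) \<longlonglongrightarrow> m"
  shows "energy L M F u \<le> m"
proof -
  obtain C where C: "\<And>f. f \<in> H1_mean_zero L \<Longrightarrow> \<bar>energy_variation L M F u f\<bar> \<le> C * grad_norm L f"
    using energy_variation_bounded[OF u] by blast
  have "energy L M F u - C * grad_norm L (\<lambda>x. p n x - u x) \<le> energy L M F (p n)" for n
  proof -
    define f where "f x = p n x - u x" for x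
    have f: "f \<in> H1_mean_zero L" unfolding f_def by (intro H1_mean_zero_diff p u)
    have "(\<lambda>x. u x + 1 * f x) = p n" by (simp add: f_def)
    hence "energy L M F u + energy_variation L M F u f + 1/4 * (grad_norm L f)\<^sup>2 \<le> energy L M F (p n)"
      using energy_expansion(1)[OF u f, of 1] by simp
    moreover have "0 \<le> (grad_norm L f)\<^sup>2" by simp
    ultimately have "energy L M F u - C * grad_norm L f \<le> energy L M F (p n)"
      using C[OF f] by linarith
    thus ?thesis by (simp add: f_def [abs_def])
  qed
  moreover have "(\<lambda>n. energy L M F u - C * grad_norm L (\<lambda>x. p n x - u x)) \<longlonglongrightarrow> energy L M F u - C * 0"
    by (intro tendsto_intros lim)
  ultimately show ?thesis using LIMSEQ_le[OF _ e] by fastforce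
qed

text \<open>
  A minimizing sequence is Cauchy in the gradient norm by the parallelogram inequality.
\<close>

lemma exists_minimizer: "\<exists>p. is_arg_min (energy L M F) (\<lambda>q. q \<in> H1_mean_zero L) p"
proof -
  let ?E = "energy L M F"
  define m where "m = Inf (?E ` H1_mean_zero L)"
  have bdd: "bdd_below (?E ` H1_mean_zero L)"
    using energy_bounded_below by (auto simp: bdd_below_def)
  have m: "m \<le> ?E q" if "q \<in> H1_mean_zero L" for q
    unfolding m_def by (intro cInf_lower imageI that bdd)
  define \<epsilon> where "\<epsilon> n = 1 / real (Suc n)" for n
  have "\<exists>q\<in>H1_mean_zero L. ?E q < m + \<epsilon> n" for n
  proof (rule ccontr)
    assume "\<not> ?thesis"
    hence "m + \<epsilon> n \<le> m"
      unfolding m_def using H1_mean_zero_0 by (intro cInf_greatest) (auto simp: not_less)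
    thus False by (simp add: \<epsilon>_def)
  qed
  then obtain p where p: "\<And>n. p n \<in> H1_mean_zero L" "\<And>n. ?E (p n) < m + \<epsilon> n"
    by metis
  have cauchy: "(grad_norm L (\<lambda>x. p j x - p k x))\<^sup>2 / 8 \<le> \<epsilon> j + \<epsilon> k" for j k
  proof -
    define c where "c = (\<lambda>x. (p j x + p k x) / 2)"
    have "c \<in> H1_mean_zero L"
      using H1_mean_zero_lincomb[OF p(1)[of j] p(1)[of k], of "1/2" "1/2"]
      by (simp add: c_def add_divide_distrib)
    hence "2 * m \<le> 2 * ?E c" by (simp add: m)
    also have "\<dots> \<le> ?E (p j) + ?E (p k) - 1/8 * (grad_norm L (\<lambda>x. p j x - p k x))\<^sup>2"
      using energy_midpoint[OF p(1)[of j] p(1)[of k], folded c_def] by linarith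
    also have "?E (p j) + ?E (p k) < 2 * m + (\<epsilon> j + \<epsilon> k)"
      using p(2)[of j] p(2)[of k] by linarith
    finally show ?thesis by simp
  qed
  have "\<exists>u\<in>H1_mean_zero L. (\<lambda>n. grad_norm L (\<lambda>x. p n x - u x)) \<longlonglongrightarrow> 0"
  proof (rule H1_complete[OF L p(1)])
    fix e :: real assume e: "e > 0"
    then obtain N where N: "\<epsilon> N < e\<^sup>2 / 16"
      using reals_Archimedean[of "e\<^sup>2 / 16"] by (auto simp: inverse_eq_divide \<epsilon>_def)
    have "grad_norm L (\<lambda>x. p j x - p k x) < e" if jk: "j \<ge> N" "k \<ge> N" for j k
    proof (rule power2_less_imp_less)
      have "\<epsilon> j \<le> \<epsilon> N" "\<epsilon> k \<le> \<epsilon> N"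
        using jk by (auto simp: \<epsilon>_def intro!: divide_left_mono)
      thus "(grad_norm L (\<lambda>x. p j x - p k x))\<^sup>2 < e\<^sup>2" using cauchy[of j k] N by linarith
    qed (use e in simp)
    thus "\<exists>N. \<forall>m\<ge>N. \<forall>n\<ge>N. grad_norm L (\<lambda>x. p m x - p n x) < e" by blast
  qed
  then obtain u where u: "u \<in> H1_mean_zero L" "(\<lambda>n. grad_norm L (\<lambda>x. p n x - u x)) \<longlonglongrightarrow> 0" by blast
  have "(\<lambda>n. ?E (p n)) \<longlonglongrightarrow> m"
  proof (rule tendsto_sandwich)
    show "\<forall>\<^sub>F n in sequentially. m \<le> ?E (p n)" using m[OF p(1)] by simp
    show "\<forall>\<^sub>F n in sequentially. ?E (p n) \<le> m + \<epsilon> n"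
      using p(2) by (intro always_eventually allI less_imp_le)
    show "(\<lambda>n. m) \<longlonglongrightarrow> m" by (rule tendsto_const)
    show "(\<lambda>n. m + \<epsilon> n) \<longlonglongrightarrow> m"
      using tendsto_add[OF tendsto_const[of m] LIMSEQ_Suc[OF lim_1_over_n]] by (simp add: \<epsilon>_def)
  qed
  hence "?E u \<le> m" by (rule energy_le_limit[OF u(1) p(1) u(2)])
  hence "is_arg_min ?E (\<lambda>q. q \<in> H1_mean_zero L) u"
    using m u(1) unfolding is_arg_min_def by (meson le_less_trans not_le)
  thus ?thesis by blast
qed

lemma minimizer_iff_weak_solution:
  assumes p: "p \<in> H1_mean_zero L"
  shows "is_arg_min (energy L M F) (\<lambda>q. q \<in> H1_mean_zero L) p \<longleftrightarrow> weak_solution L M F p"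
proof
  assume min: "is_arg_min (energy L M F) (\<lambda>q. q \<in> H1_mean_zero L) p"
  show "weak_solution L M F p"
    unfolding weak_solution_iff
  proof
    fix f assume f: "f \<in> H1_mean_zero L"
    show "energy_variation L M F p f = 0"
    proof (rule linear_coefficient_eq_0)
      fix t
      have "(\<lambda>x. p x + t * f x) \<in> H1_mean_zero L" using H1_mean_zero_lincomb[OF p f, of 1 t] by simp
      hence "energy L M F p \<le> energy L M F (\<lambda>x. p x + t * f x)"
        using min by (auto simp: is_arg_min_def not_less)
      thus "0 \<le> t * energy_variation L M F p f + 1/2 * t\<^sup>2 * (grad_norm L f)\<^sup>2"
        using energy_expansion(2)[OF p f, of t] by linarith
    qed simp
  qed
next
  assume "weak_solution L M F p"
  hence crit: "\<And>f. f \<in> H1_mean_zero L \<Longrightarrow> energy_variation L M F p f = 0"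
    by (simp add: weak_solution_iff)
  have "energy L M F p \<le> energy L M F q" if q: "q \<in> H1_mean_zero L" for q
  proof -
    have f: "(\<lambda>x. q x - p x) \<in> H1_mean_zero L" by (rule H1_mean_zero_diff[OF q p])
    have "energy L M F p + 1/4 * (grad_norm L (\<lambda>x. q x - p x))\<^sup>2 \<le> energy L M F q"
      using energy_expansion(1)[OF p f, of 1] crit[OF f] by simp
    moreover have "0 \<le> (grad_norm L (\<lambda>x. q x - p x))\<^sup>2" by simp
    ultimately show ?thesis by linarith
  qed
  thus "is_arg_min (energy L M F) (\<lambda>q. q \<in> H1_mean_zero L) p"
    using p by (auto simp: is_arg_min_def not_less)
qed

text \<open>
  At a critical point the expansion has no linear term, so the energy of \<open>q\<close> exceeds that of \<open>p\<close> by
  an amount comparable with the squared gradient norm of \<open>q - p\<close>, and that norm vanishes exactly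
  when \<open>q\<close> and \<open>p\<close> agree almost everywhere.
\<close>

lemma minimizer_iff_AE_eq:
  assumes p: "is_arg_min (energy L M F) (\<lambda>q. q \<in> H1_mean_zero L) p" and q: "q \<in> H1_mean_zero L"
  shows "is_arg_min (energy L M F) (\<lambda>q. q \<in> H1_mean_zero L) q \<longleftrightarrow> (AE x in torus L. q x = p x)"
proof -
  have pH: "p \<in> H1_mean_zero L" using p by (simp add: is_arg_min_def)
  define f where "f x = q x - p x" for x
  have f: "f \<in> H1_mean_zero L" unfolding f_def by (rule H1_mean_zero_diff[OF q pH])
  have qf: "(\<lambda>x. p x + 1 * f x) = q" by (simp add: f_def)
  have "energy_variation L M F p f = 0"
    using p f minimizer_iff_weak_solution[OF pH] by (simp add: weak_solution_iff)
  hence ex: "energy L M F p + 1/4 * (grad_norm L f)\<^sup>2 \<le> energy L M F q"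
    "energy L M F q \<le> energy L M F p + 1/2 * (grad_norm L f)\<^sup>2"
    using energy_expansion[OF pH f, of 1] unfolding qf by simp_all
  have "is_arg_min (energy L M F) (\<lambda>q. q \<in> H1_mean_zero L) q \<longleftrightarrow> energy L M F q \<le> energy L M F p"
    using p q by (auto simp: is_arg_min_def not_less intro: order_trans)
  also have "\<dots> \<longleftrightarrow> grad_norm L f = 0"
  proof
    assume "energy L M F q \<le> energy L M F p"
    hence "(grad_norm L f)\<^sup>2 \<le> 0" using ex(1) by linarith
    thus "grad_norm L f = 0" by simp
  qed (use ex(2) in simp)
  also have "\<dots> \<longleftrightarrow> (AE x in torus L. f x = 0)" by (rule AE_eq_0_iff_grad_norm[OF L f, symmetric])
  finally show ?thesis by (simp add: f_def)
qed

end

theorem theorem5p1: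
  fixes L :: real and M :: "real^3 \<Rightarrow> real" and PVe :: "(real^3 \<Rightarrow> real) \<Rightarrow> real"
  assumes "L > 0"
    and "M \<in> torus_L2 L"
    and "PVe \<in> H_minus1 L"
  shows "\<exists>p\<in>H1_mean_zero L.
           is_arg_min (energy L M PVe) (\<lambda>q. q \<in> H1_mean_zero L) p \<and>
           weak_solution L M PVe p \<and>
           (\<forall>q\<in>H1_mean_zero L.
              (is_arg_min (energy L M PVe) (\<lambda>r. r \<in> H1_mean_zero L) q
                 \<longleftrightarrow> (AE x in torus L. q x = p x)) \<and>
              (weak_solution L M PVe q \<longleftrightarrow> (AE x in torus L. q x = p x)))"
proof -
  obtain p where p: "is_arg_min (energy L M PVe) (\<lambda>q. q \<in> H1_mean_zero L) p"
    using exists_minimizer[OF assms] by blast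
  hence "p \<in> H1_mean_zero L" by (simp add: is_arg_min_def)
  with p show ?thesis
    using minimizer_iff_weak_solution[OF assms] minimizer_iff_AE_eq[OF assms p] by blast
qed

end
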